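(* Let $N\ge4$ and $\mu_1,\mu_2,\beta>0$. Then the system $$-\Delta u=\mu_1u^{2^*-1}+\beta u^{\frac{2^*}{2}-1}v^{\frac{2^*}{2}},\qquad -\Delta v=\mu_2v^{2^*-1}+\beta v^{\frac{2^*}{2}-1}u^{\frac{2^*}{2}}\qquad\text{in }B_2\setminus\{0\},$$ with $u,v>0$ and $u,v\in C^2(B_2\setminus\{0\})$, has no semi-singular solutions.
   Context: $2^*:=\frac{2N}{N-2}$ and $B_r:=\{x\in\mathbb R^N:|x|<r\}$. A solution $(u,v)$ is called semi-singular if one of $u,v$ is bounded near $x=0$ and the other is unbounded near $x=0$. *)

theory Defs
  imports "HOL-Analysis.Analysis"
begin

definition partial_derivative :: "'a::euclidean_space \<Rightarrow> ('a \<Rightarrow> real) \<Rightarrow> 'a \<Rightarrow> real" where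
  "partial_derivative b f x = frechet_derivative f (at x) b"

text \<open>The class \<open>C\<^sup>k(S)\<close>, intended for open \<open>S\<close> only: differentiability is taken with respect
  to the full neighbourhood filter \<open>at x\<close>.\<close>

primrec Ck_on :: "nat \<Rightarrow> 'a::euclidean_space set \<Rightarrow> ('a \<Rightarrow> real) \<Rightarrow> bool" where
  "Ck_on 0 S f \<longleftrightarrow> continuous_on S f"
| "Ck_on (Suc k) S f \<longleftrightarrow>
     (\<forall>x\<in>S. f differentiable (at x)) \<and> (\<forall>b\<in>Basis. Ck_on k S (partial_derivative b f))"

definition laplacian :: "('a::euclidean_space \<Rightarrow> real) \<Rightarrow> 'a \<Rightarrow> real" where
  "laplacian f x = (\<Sum>b\<in>Basis. partial_derivative b (partial_derivative b f) x)"

definition critical_exponent :: "nat \<Rightarrow> real" where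
  "critical_exponent N = 2 * real N / (real N - 2)"

text \<open>Functions are total, so their value at the origin is arbitrary and never used.\<close>

definition positive_solution ::
    "real \<Rightarrow> real \<Rightarrow> real \<Rightarrow> (real^'n::finite \<Rightarrow> real) \<Rightarrow> (real^'n \<Rightarrow> real) \<Rightarrow> bool" where
  "positive_solution \<mu>\<^sub>1 \<mu>\<^sub>2 \<beta> u v \<longleftrightarrow>
     (let \<Omega> = ball 0 2 - {0}; p = critical_exponent CARD('n) in
        Ck_on 2 \<Omega> u \<and> Ck_on 2 \<Omega> v \<and>
        (\<forall>x\<in>\<Omega>. u x > 0 \<and> v x > 0 \<and>
          - laplacian u x = \<mu>\<^sub>1 * u x powr (p - 1) + \<beta> * u x powr (p / 2 - 1) * v x powr (p / 2) \<and>
          - laplacian v x = \<mu>\<^sub>2 * v x powr (p - 1) + \<beta> * v x powr (p / 2 - 1) * u x powr (p / 2)))"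

text \<open>The filter \<open>at 0\<close> excludes the origin itself, so \<open>Bfun f (at 0)\<close> says that \<open>f\<close> is bounded
  on some punctured ball around the origin.\<close>

definition semi_singular :: "('a::real_normed_vector \<Rightarrow> real) \<Rightarrow> ('a \<Rightarrow> real) \<Rightarrow> bool" where
  "semi_singular u v \<longleftrightarrow>
     (Bfun u (at 0) \<and> \<not> Bfun v (at 0)) \<or> (\<not> Bfun u (at 0) \<and> Bfun v (at 0))"

end

theory Submission
  imports Defs
begin

text \<open>Suppose that \<open>u\<close> is bounded near the origin; it is to be shown that \<open>v\<close> is bounded as well, the other
  case being symmetric. Write \<open>k = N - 2\<close> and \<open>a = 2 / k\<close>. Both functions are superharmonic in the punctured ball,
  so they are at least some \<open>m > 0\<close> near the origin (\<open>lower_bound\<close>).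

  If \<open>v\<close> had size \<open>|x| powr - (k / 2)\<close>, the usual size of a singular solution, then \<open>- \<Delta> u\<close>
  would be at least a multiple of \<open>v powr (1 + a)\<close>, that is of \<open>|x| powr - (N / 2)\<close>, and for \<open>N \<ge> 4\<close> the
  Newtonian potential of this function is infinite at the origin, which contradicts the boundedness of \<open>u\<close>.
  To make this precise, solutions that concentrate in bubbles have to be excluded, and pointwise
  information on \<open>v\<close> is needed. Both come from the method of moving spheres: about centres \<open>y \<noteq> 0\<close>, the Kelvin transforms of
  \<open>u\<close> and \<open>v\<close> lie below \<open>u\<close> and \<open>v\<close> for all radii up to a size governed by the lower bound \<open>m\<close> (\<open>below_all\<close>).
  This is the place where the critical exponent and the sign of \<open>\<beta>\<close> enter. The infinitesimal form of the comparison bounds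
  the logarithmic gradient of \<open>v\<close> (\<open>gradient_bound\<close>), which is incompatible with a concentrated bubble
  (\<open>blowup_scale\<close>). The consequences are \<open>v \<le> C |x| powr - (k / 2)\<close> (\<open>upper_bound\<close>) and a Harnack inequality
  (\<open>harnack\<close>).

  The potential argument then has a scale-by-scale form: each scale contributes a multiple of
  \<open>v powr (1 + a) |x|\<^sup>2\<close> to the infimum of \<open>u\<close> (\<open>lift_lower_bound\<close>), so this quantity tends to zero
  (\<open>charge_vanishes\<close>). For \<open>N \<ge> 4\<close> it controls \<open>|x|\<^sup>2 v powr (2 a)\<close>, and two comparisons with powers of \<open>|x|\<close>
  show that \<open>v\<close> is bounded (\<open>v_bounded\<close>).

  All comparisons are instances of one weak minimum principle on compact sets, in which the origin may be ignored
  for functions that are small compared with the fundamental solution. Integrals are not used.\<close>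

section \<open>Functions with a Laplacian at a point\<close>

text \<open>\<open>has_grad_hess f G H x\<close>: near \<open>x\<close> the function \<open>f\<close> has gradient \<open>G\<close>, and \<open>G\<close> is
  differentiable at \<open>x\<close> with derivative \<open>H\<close>, the Hessian. Only differentiability of the gradient at
  the single point \<open>x\<close> is required; continuity of \<open>H\<close> is never needed.\<close>

definition has_grad_hess ::
    "('a::euclidean_space \<Rightarrow> real) \<Rightarrow> ('a \<Rightarrow> 'a) \<Rightarrow> ('a \<Rightarrow> 'a) \<Rightarrow> 'a \<Rightarrow> bool" where
  "has_grad_hess f G H x \<longleftrightarrow>
     (\<forall>\<^sub>F z in nhds x. (f has_derivative (\<lambda>h. G z \<bullet> h)) (at z)) \<and> (G has_derivative H) (at x)"

text \<open>The Laplacian as a relation: \<open>L\<close> is the trace of some Hessian of \<open>f\<close> at \<open>x\<close>.\<close>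

definition has_laplacian :: "('a::euclidean_space \<Rightarrow> real) \<Rightarrow> real \<Rightarrow> 'a \<Rightarrow> bool" where
  "has_laplacian f L x \<longleftrightarrow> (\<exists>G H. has_grad_hess f G H x \<and> L = (\<Sum>b\<in>Basis. H b \<bullet> b))"

lemma has_laplacianI:
  assumes "has_grad_hess f G H x" "(\<Sum>b\<in>Basis. H b \<bullet> b) = L"
  shows "has_laplacian f L x"
  using assms unfolding has_laplacian_def by blast

lemma has_laplacian_const: "has_laplacian (\<lambda>_. c) 0 x"
  by (rule has_laplacianI[where G="\<lambda>_. 0" and H="\<lambda>_. 0"]) (auto simp: has_grad_hess_def)

lemma has_laplacian_add:
  assumes "has_laplacian f L x" "has_laplacian g M x"
  shows "has_laplacian (\<lambda>z. f z + g z) (L + M) x"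
proof -
  obtain G H where f: "has_grad_hess f G H x" and L: "L = (\<Sum>b\<in>Basis. H b \<bullet> b)"
    using assms(1) unfolding has_laplacian_def by blast
  obtain G' H' where g: "has_grad_hess g G' H' x" and M: "M = (\<Sum>b\<in>Basis. H' b \<bullet> b)"
    using assms(2) unfolding has_laplacian_def by blast
  have "has_grad_hess (\<lambda>z. f z + g z) (\<lambda>z. G z + G' z) (\<lambda>h. H h + H' h) x"
  proof -
    have fg: "\<forall>\<^sub>F z in nhds x. (f has_derivative (\<lambda>h. G z \<bullet> h)) (at z)"
      "\<forall>\<^sub>F z in nhds x. (g has_derivative (\<lambda>h. G' z \<bullet> h)) (at z)"
      and GG': "(G has_derivative H) (at x)" "(G' has_derivative H') (at x)"
      using f g unfolding has_grad_hess_def by blast+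
    from fg have "\<forall>\<^sub>F z in nhds x. ((\<lambda>z. f z + g z) has_derivative (\<lambda>h. (G z + G' z) \<bullet> h)) (at z)"
      by eventually_elim (simp add: inner_add_left has_derivative_add)
    then show ?thesis
      unfolding has_grad_hess_def using has_derivative_add[OF GG'] by blast
  qed
  then show ?thesis
    by (rule has_laplacianI) (simp add: L M inner_add_left sum.distrib)
qed

lemma has_laplacian_cmult:
  assumes "has_laplacian f L x"
  shows "has_laplacian (\<lambda>z. c * f z) (c * L) x"
proof -
  obtain G H where f: "has_grad_hess f G H x" and L: "L = (\<Sum>b\<in>Basis. H b \<bullet> b)"
    using assms(1) unfolding has_laplacian_def by blast
  have "has_grad_hess (\<lambda>z. c * f z) (\<lambda>z. c *\<^sub>R G z) (\<lambda>h. c *\<^sub>R H h) x"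
  proof -
    have fg: "\<forall>\<^sub>F z in nhds x. (f has_derivative (\<lambda>h. G z \<bullet> h)) (at z)"
      and GG': "(G has_derivative H) (at x)"
      using f unfolding has_grad_hess_def by blast+
    from fg have "\<forall>\<^sub>F z in nhds x. ((\<lambda>z. c * f z) has_derivative (\<lambda>h. (c *\<^sub>R G z) \<bullet> h)) (at z)"
      by eventually_elim (simp add: has_derivative_mult_right)
    then show ?thesis
      unfolding has_grad_hess_def using has_derivative_scaleR_right[OF GG'] by blast
  qed
  then show ?thesis
    by (rule has_laplacianI) (simp add: L sum_distrib_left)
qed

lemma has_laplacian_diff:
  assumes "has_laplacian f L x" "has_laplacian g M x"
  shows "has_laplacian (\<lambda>z. f z - g z) (L - M) x"
  using has_laplacian_add[OF assms(1) has_laplacian_cmult[OF assms(2), of "-1"]] by simp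

lemma has_laplacian_local_min:
  assumes f: "has_laplacian f L x" and min: "\<forall>\<^sub>F z in nhds x. f x \<le> f z"
  shows "0 \<le> L"
proof -
  obtain G H where gh: "has_grad_hess f G H x" and L: "L = (\<Sum>b\<in>Basis. H b \<bullet> b)"
    using f unfolding has_laplacian_def by blast
  then have G: "\<forall>\<^sub>F z in nhds x. (f has_derivative (\<lambda>h. G z \<bullet> h)) (at z)"
    and H: "(G has_derivative H) (at x)" unfolding has_grad_hess_def by auto
  obtain e where e: "e > 0" "\<And>z. dist z x < e \<Longrightarrow> (f has_derivative (\<lambda>h. G z \<bullet> h)) (at z) \<and> f x \<le> f z"
    using eventually_conj[OF G min] unfolding eventually_nhds_metric by blast
  have Gx: "G x = 0"
  proof -
    have "(\<lambda>h. G x \<bullet> h) = (\<lambda>h. 0)"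
      by (rule has_derivative_local_min[of f _ x]) (use e G min in \<open>auto simp: eventually_nhds eventually_at_filter elim!: eventually_mono\<close>)
    then have "G x \<bullet> G x = 0" by meson
    then show ?thesis by simp
  qed
  have "0 \<le> H b \<bullet> b" if b: "b \<in> Basis" for b
  proof (rule ccontr)
    assume neg: "\<not> 0 \<le> H b \<bullet> b"
    define \<phi> where "\<phi> t = f (x + t *\<^sub>R b)" for t
    define \<psi> where "\<psi> t = G (x + t *\<^sub>R b) \<bullet> b" for t
    have line: "((\<lambda>t. x + t *\<^sub>R b) has_derivative (\<lambda>h. h *\<^sub>R b)) (at t)" for t
      by (auto intro!: derivative_eq_intros)
    have d1: "(\<phi> has_real_derivative \<psi> t) (at t)" if "\<bar>t\<bar> < e" for t
    proof -
      have "(f has_derivative (\<lambda>h. G (x + t *\<^sub>R b) \<bullet> h)) (at (x + t *\<^sub>R b))"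
        using e(2)[of "x + t *\<^sub>R b"] that b by (auto simp: dist_norm)
      then have "((\<lambda>t. f (x + t *\<^sub>R b)) has_derivative (\<lambda>h. G (x + t *\<^sub>R b) \<bullet> (h *\<^sub>R b))) (at t)"
        by (rule has_derivative_compose[OF line])
      then show ?thesis unfolding \<phi>_def \<psi>_def has_field_derivative_def
        by (auto simp: elim!: has_derivative_eq_rhs)
    qed
    have "(G has_derivative H) (at (x + 0 *\<^sub>R b))" using H by simp
    then have "((\<lambda>t. G (x + t *\<^sub>R b)) has_derivative (\<lambda>h. H (h *\<^sub>R b))) (at 0)"
      by (rule has_derivative_compose[OF line])
    then have "(\<psi> has_derivative (\<lambda>h. H (h *\<^sub>R b) \<bullet> b)) (at 0)"
      unfolding \<psi>_def by (auto intro!: derivative_eq_intros)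
    moreover have "H (h *\<^sub>R b) \<bullet> b = (H b \<bullet> b) * h" for h
      using linear_scale[OF has_derivative_linear[OF H]] by simp
    ultimately have d2: "(\<psi> has_real_derivative (H b \<bullet> b)) (at 0)"
      by (simp add: has_field_derivative_def)
    obtain d where d: "d > 0" "\<And>h. 0 < h \<Longrightarrow> h < d \<Longrightarrow> \<psi> h < \<psi> 0"
      using DERIV_neg_dec_right[OF d2] neg by auto
    \<comment> \<open>The directional derivative is negative just to the right of \<open>0\<close>, so \<open>f\<close> drops below its minimum.\<close>
    define t where "t = min d e / 2"
    have t: "0 < t" "t < d" "t < e" using d(1) e(1) by (auto simp: t_def)
    obtain z where z: "0 < z" "z < t" "\<phi> t - \<phi> 0 = (t - 0) * \<psi> z"
      using MVT2[of 0 t \<phi> \<psi>] t d1 by auto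
    have "\<psi> z < 0" using d(2)[of z] z t Gx by (simp add: \<psi>_def)
    then have "\<phi> t < \<phi> 0" using z t by (smt (verit) mult_pos_neg)
    moreover have "\<phi> 0 \<le> \<phi> t" using e(2)[of "x + t *\<^sub>R b"] t b by (simp add: \<phi>_def dist_norm)
    ultimately show False by simp
  qed
  then show ?thesis unfolding L by (simp add: sum_nonneg)
qed

lemma has_laplacian_sq:
  "has_laplacian (\<lambda>z. (norm (z - c))\<^sup>2) (2 * DIM('a)) (x::'a::euclidean_space)"
proof (rule has_laplacianI)
  show "has_grad_hess (\<lambda>z. (norm (z - c))\<^sup>2) (\<lambda>z. 2 *\<^sub>R (z - c)) (\<lambda>h. 2 *\<^sub>R h) x"
    unfolding has_grad_hess_def power2_norm_eq_inner
    by (auto intro!: derivative_eq_intros always_eventually simp: inner_commute)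
qed (simp add: inner_Basis)

text \<open>The gradient of a function, assembled from its partial derivatives.\<close>

definition grad :: "('a::euclidean_space \<Rightarrow> real) \<Rightarrow> 'a \<Rightarrow> 'a" where
  "grad f x = (\<Sum>b\<in>Basis. partial_derivative b f x *\<^sub>R b)"

lemma has_derivative_grad:
  assumes "f differentiable (at x)"
  shows "(f has_derivative (\<lambda>h. grad f x \<bullet> h)) (at x)"
proof -
  have d: "(f has_derivative frechet_derivative f (at x)) (at x)"
    using assms frechet_derivative_works by blast
  then have lin: "linear (frechet_derivative f (at x))" by (rule has_derivative_linear)
  have "frechet_derivative f (at x) h = grad f x \<bullet> h" for h
  proof -
    have "frechet_derivative f (at x) h = frechet_derivative f (at x) (\<Sum>b\<in>Basis. (h \<bullet> b) *\<^sub>R b)"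
      by (simp add: euclidean_representation)
    also have "\<dots> = (\<Sum>b\<in>Basis. (h \<bullet> b) * frechet_derivative f (at x) b)"
      by (simp add: linear_sum[OF lin] linear_scale[OF lin])
    also have "\<dots> = grad f x \<bullet> h"
      unfolding grad_def partial_derivative_def inner_sum_left
      by (intro sum.cong) (auto simp: inner_commute)
    finally show ?thesis .
  qed
  then show ?thesis using d by (metis (no_types, lifting) ext)
qed

lemma Ck_on_2D:
  assumes "Ck_on 2 S f" "open S" "x \<in> S"
  shows "(f has_derivative (\<lambda>h. grad f x \<bullet> h)) (at x)"
    and "isCont (grad f) x"
    and "has_laplacian f (laplacian f x) x"
proof -
  have C: "\<And>x. x \<in> S \<Longrightarrow> f differentiable (at x)"
    "\<And>x b. x \<in> S \<Longrightarrow> b \<in> Basis \<Longrightarrow> partial_derivative b f differentiable (at x)"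
    using assms(1) by (auto simp: numeral_2_eq_2)
  show D: "(f has_derivative (\<lambda>h. grad f x \<bullet> h)) (at x)"
    using has_derivative_grad C(1) assms(3) by blast
  define H where "H h = (\<Sum>b\<in>Basis. frechet_derivative (partial_derivative b f) (at x) h *\<^sub>R b)" for h
  have "\<And>b. b \<in> Basis \<Longrightarrow> (partial_derivative b f has_derivative
      frechet_derivative (partial_derivative b f) (at x)) (at x)"
    using C(2) assms(3) frechet_derivative_works by blast
  then have H: "(grad f has_derivative H) (at x)"
    unfolding grad_def[abs_def] H_def[abs_def] by (intro has_derivative_sum has_derivative_scaleR_left)
  then show "isCont (grad f) x" by (rule has_derivative_continuous)
  have "\<forall>\<^sub>F z in nhds x. (f has_derivative (\<lambda>h. grad f z \<bullet> h)) (at z)"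
    using eventually_nhds_in_open[OF assms(2,3)]
    by eventually_elim (use C(1) has_derivative_grad in blast)
  with H have gh: "has_grad_hess f (grad f) H x" unfolding has_grad_hess_def by blast
  have "H c \<bullet> c = partial_derivative c (partial_derivative c f) x" if "c \<in> Basis" for c
    using that unfolding H_def partial_derivative_def[of c "partial_derivative c f"]
    by (simp add: inner_sum_left inner_Basis if_distrib[where f="\<lambda>x. _ * x"] cong: if_cong)
  then show "has_laplacian f (laplacian f x) x"
    by (intro has_laplacianI[OF gh]) (simp add: laplacian_def)
qed

lemma has_laplacian_translate:
  assumes "has_laplacian f L x"
  shows "has_laplacian (\<lambda>z. f (z - c)) L (x + c)"
proof -
  obtain G H where G: "\<forall>\<^sub>F z in nhds x. (f has_derivative (\<lambda>h. G z \<bullet> h)) (at z)"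
    and H: "(G has_derivative H) (at x)" and L: "L = (\<Sum>b\<in>Basis. H b \<bullet> b)"
    using assms unfolding has_laplacian_def has_grad_hess_def by blast
  have shift: "((\<lambda>z. z - c) has_derivative (\<lambda>h. h)) (at z)" for z
    by (auto intro!: derivative_eq_intros)
  have "filterlim (\<lambda>z. z - c) (nhds x) (nhds (x + c))"
    using tendsto_at_iff_tendsto_nhds[of "\<lambda>z. z - c" "x + c"]
      isCont_def[of "x + c" "\<lambda>z. z - c"] by simp
  then have "\<forall>\<^sub>F z in nhds (x + c). (f has_derivative (\<lambda>h. G (z - c) \<bullet> h)) (at (z - c))"
    by (rule eventually_compose_filterlim[OF G])
  then have "\<forall>\<^sub>F z in nhds (x + c). ((\<lambda>z. f (z - c)) has_derivative (\<lambda>h. G (z - c) \<bullet> h)) (at z)"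
    by eventually_elim (rule has_derivative_compose[OF shift])
  moreover have "((\<lambda>z. G (z - c)) has_derivative H) (at (x + c))"
    using has_derivative_compose[OF shift[of "x + c"], of G H] H by simp
  ultimately show ?thesis
    unfolding has_laplacian_def has_grad_hess_def
    by (intro exI[of _ "\<lambda>z. G (z - c)"] exI[of _ H]) (auto simp: L)
qed

lemma has_laplacian_cong:
  assumes "has_laplacian f L x" "\<forall>\<^sub>F z in nhds x. f z = g z"
  shows "has_laplacian g L x"
proof -
  obtain G H where G: "\<forall>\<^sub>F z in nhds x. (f has_derivative (\<lambda>h. G z \<bullet> h)) (at z)"
    and H: "(G has_derivative H) (at x)" and L: "L = (\<Sum>b\<in>Basis. H b \<bullet> b)"
    using assms unfolding has_laplacian_def has_grad_hess_def by blast
  have "\<forall>\<^sub>F z in nhds x. \<forall>\<^sub>F z' in nhds z. f z' = g z'"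
    using assms(2) by (simp add: eventually_eventually)
  with G have "\<forall>\<^sub>F z in nhds x. (g has_derivative (\<lambda>h. G z \<bullet> h)) (at z)"
  proof eventually_elim
    case (elim z)
    then have "f z = g z" using eventually_nhds_x_imp_x by blast
    with elim show ?case
      by (intro has_derivative_transform_eventually[OF elim(1)])
         (auto simp: eventually_at_filter elim: eventually_mono)
  qed
  then show ?thesis
    unfolding has_laplacian_def has_grad_hess_def using L H by blast
qed

lemma has_grad_hess_mult:
  assumes f: "has_grad_hess f G H x" and g: "has_grad_hess g G' H' x"
  shows "has_grad_hess (\<lambda>z. f z * g z) (\<lambda>z. f z *\<^sub>R G' z + g z *\<^sub>R G z)
    (\<lambda>h. (f x *\<^sub>R H' h + (G x \<bullet> h) *\<^sub>R G' x) + (g x *\<^sub>R H h + (G' x \<bullet> h) *\<^sub>R G x)) x"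
proof -
  have ev: "\<forall>\<^sub>F z in nhds x. (f has_derivative (\<lambda>h. G z \<bullet> h)) (at z)"
    "\<forall>\<^sub>F z in nhds x. (g has_derivative (\<lambda>h. G' z \<bullet> h)) (at z)"
    and H: "(G has_derivative H) (at x)" "(G' has_derivative H') (at x)"
    using f g unfolding has_grad_hess_def by blast+
  from ev have "\<forall>\<^sub>F z in nhds x.
      ((\<lambda>z. f z * g z) has_derivative (\<lambda>h. (f z *\<^sub>R G' z + g z *\<^sub>R G z) \<bullet> h)) (at z)"
  proof eventually_elim
    case (elim z)
    show ?case
      by (rule has_derivative_eq_rhs[OF has_derivative_mult[OF elim]])
         (auto simp: fun_eq_iff inner_add_left)
  qed
  moreover have "((\<lambda>z. f z *\<^sub>R G' z + g z *\<^sub>R G z) has_derivative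
     (\<lambda>h. (f x *\<^sub>R H' h + (G x \<bullet> h) *\<^sub>R G' x) + (g x *\<^sub>R H h + (G' x \<bullet> h) *\<^sub>R G x))) (at x)"
    using ev[THEN eventually_nhds_x_imp_x] H
    by (intro has_derivative_add has_derivative_scaleR) auto
  ultimately show ?thesis unfolding has_grad_hess_def by blast
qed

lemma sum_Basis_inner_mult:
  "(\<Sum>b\<in>Basis. (x \<bullet> b) * (y \<bullet> b)) = x \<bullet> (y::'a::euclidean_space)"
  by (simp add: euclidean_inner[of x y])

lemma laplacian_mult:
  assumes f: "has_grad_hess f G H x" and g: "has_grad_hess g G' H' x"
  shows "has_laplacian (\<lambda>z. f z * g z)
    (f x * (\<Sum>b\<in>Basis. H' b \<bullet> b) + 2 * (G x \<bullet> G' x) + g x * (\<Sum>b\<in>Basis. H b \<bullet> b)) x"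
  by (rule has_laplacianI[OF has_grad_hess_mult[OF assms]])
     (simp add: inner_add_left sum.distrib sum_distrib_left[symmetric] sum_Basis_inner_mult
        inner_commute[of "G' x" "G x"])

lemma has_derivative_norm_powr:
  fixes z :: "'a::euclidean_space"
  assumes "z \<noteq> 0"
  shows "((\<lambda>z. norm z powr p) has_derivative (\<lambda>h. ((p * norm z powr (p - 2)) *\<^sub>R z) \<bullet> h)) (at z)"
proof -
  have "(norm has_derivative (\<lambda>h. sgn z \<bullet> h)) (at z)"
    using has_derivative_norm[OF assms] by (simp add: inner_commute)
  moreover have "((\<lambda>r. r powr p) has_derivative (\<lambda>h. h * (p * norm z powr (p - 1)))) (at (norm z))"
    using has_real_derivative_powr[of "norm z" p] assms
    by (auto simp: has_field_derivative_def elim!: has_derivative_eq_rhs)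
  ultimately have "((\<lambda>z. norm z powr p) has_derivative (\<lambda>h. (sgn z \<bullet> h) * (p * norm z powr (p - 1)))) (at z)"
    by (rule has_derivative_compose)
  moreover have "norm z powr (p - 1) = norm z powr (p - 2) * norm z"
    using assms powr_mult_base[of "norm z" "p - 2"] by (simp add: mult.commute)
  ultimately show ?thesis
    using assms by (elim has_derivative_eq_rhs) (auto simp: fun_eq_iff sgn_div_norm field_simps)
qed

lemma has_grad_hess_norm_powr:
  fixes x :: "'a::euclidean_space"
  assumes "x \<noteq> 0"
  shows "has_grad_hess (\<lambda>z. norm z powr p) (\<lambda>z. (p * norm z powr (p - 2)) *\<^sub>R z)
    (\<lambda>h. (p * norm x powr (p - 2)) *\<^sub>R h + (p * ((((p - 2) * norm x powr (p - 4)) *\<^sub>R x) \<bullet> h)) *\<^sub>R x) x"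
proof -
  have "\<forall>\<^sub>F z in nhds x. z \<noteq> 0"
    using assms by (intro t1_space_nhds) 
  then have "\<forall>\<^sub>F z in nhds x. ((\<lambda>z. norm z powr p) has_derivative
      (\<lambda>h. ((p * norm z powr (p - 2)) *\<^sub>R z) \<bullet> h)) (at z)"
    by eventually_elim (rule has_derivative_norm_powr)
  moreover have "((\<lambda>z. (p * norm z powr (p - 2)) *\<^sub>R z) has_derivative
     (\<lambda>h. (p * norm x powr (p - 2)) *\<^sub>R h + (p * ((((p - 2) * norm x powr (p - 4)) *\<^sub>R x) \<bullet> h)) *\<^sub>R x)) (at x)"
    using has_derivative_scaleR[OF has_derivative_mult_right[OF has_derivative_norm_powr[OF assms, of "p - 2"], of p] has_derivative_ident]
    by simp
  ultimately show ?thesis unfolding has_grad_hess_def by blast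
qed

lemma trace_norm_powr:
  fixes x :: "'a::euclidean_space"
  assumes "x \<noteq> 0"
  shows "(\<Sum>b\<in>Basis. ((p * norm x powr (p - 2)) *\<^sub>R b
      + (p * ((((p - 2) * norm x powr (p - 4)) *\<^sub>R x) \<bullet> b)) *\<^sub>R x) \<bullet> b)
    = p * (p + DIM('a) - 2) * norm x powr (p - 2)"
proof -
  have n: "norm x powr (p - 4) * (norm x * norm x) = norm x powr (p - 2)"
    using assms by (simp add: powr_add[symmetric] powr_numeral[symmetric] power2_eq_square[symmetric] del: powr_numeral)
  have "(\<Sum>b\<in>Basis. ((p * norm x powr (p - 2)) *\<^sub>R b
      + (p * ((((p - 2) * norm x powr (p - 4)) *\<^sub>R x) \<bullet> b)) *\<^sub>R x) \<bullet> b)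
    = (\<Sum>b\<in>(Basis::'a set). p * norm x powr (p - 2) + p * (p - 2) * norm x powr (p - 4) * ((x \<bullet> b) * (x \<bullet> b)))"
    by (intro sum.cong) (auto simp: inner_add_left algebra_simps)
  also have "\<dots> = DIM('a) * (p * norm x powr (p - 2)) + p * (p - 2) * norm x powr (p - 4) * (norm x * norm x)"
    by (simp add: sum.distrib sum_distrib_left[symmetric] sum_Basis_inner_mult norm_eq_square[symmetric] power2_norm_eq_inner[symmetric] power2_eq_square)
  also have "\<dots> = DIM('a) * (p * norm x powr (p - 2)) + p * (p - 2) * norm x powr (p - 2)"
    using n by (simp add: mult.assoc)
  finally show ?thesis by (simp add: algebra_simps)
qed

lemma has_laplacian_norm_powr:
  fixes x :: "'a::euclidean_space"
  assumes "x \<noteq> c"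
  shows "has_laplacian (\<lambda>z. norm (z - c) powr p) (p * (p + DIM('a) - 2) * norm (x - c) powr (p - 2)) x"
proof -
  have "x - c \<noteq> 0" using assms by simp
  from has_laplacian_translate[OF has_laplacianI[OF has_grad_hess_norm_powr[OF this] trace_norm_powr[OF this]], of c p]
  show ?thesis by simp
qed

section \<open>Inversion and the Kelvin transform\<close>

lemma has_derivative_inversion:
  fixes z :: "'a::euclidean_space"
  assumes "z \<noteq> 0"
  shows "((\<lambda>z. (l / (z \<bullet> z)) *\<^sub>R z) has_derivative
    (\<lambda>h. (l / (z \<bullet> z)) *\<^sub>R h - (2 * l * (z \<bullet> h) / (z \<bullet> z)\<^sup>2) *\<^sub>R z)) (at z)"
  using assms
  by (auto intro!: derivative_eq_intros simp: fun_eq_iff inner_commute power2_eq_square field_simps)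

lemma has_grad_hess_inversion:
  fixes x :: "'a::euclidean_space" and U :: "'a \<Rightarrow> real"
  assumes U: "has_grad_hess U G H ((l / (x \<bullet> x)) *\<^sub>R x)" and x: "x \<noteq> 0"
  defines "s \<equiv> x \<bullet> x"
  defines "g \<equiv> G ((l / s) *\<^sub>R x)"
  defines "DI \<equiv> \<lambda>h. (l / s) *\<^sub>R h - (2 * l * (x \<bullet> h) / s\<^sup>2) *\<^sub>R x"
  shows "has_grad_hess (\<lambda>z. U ((l / (z \<bullet> z)) *\<^sub>R z))
    (\<lambda>z. (l / (z \<bullet> z)) *\<^sub>R G ((l / (z \<bullet> z)) *\<^sub>R z)
       - (2 * l / (z \<bullet> z)\<^sup>2 * (z \<bullet> G ((l / (z \<bullet> z)) *\<^sub>R z))) *\<^sub>R z)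
    (\<lambda>h. ((l / s) *\<^sub>R H (DI h) + (- (2 * l * (x \<bullet> h) / s\<^sup>2)) *\<^sub>R g)
      - ((2 * l / s\<^sup>2 * (x \<bullet> g)) *\<^sub>R h
        + (2 * l / s\<^sup>2 * (x \<bullet> H (DI h) + h \<bullet> g) + - (8 * l * (x \<bullet> h) / s ^ 3) * (x \<bullet> g)) *\<^sub>R x)) x"
proof -
  let ?I = "\<lambda>z. (l / (z \<bullet> z)) *\<^sub>R z"
  have G: "\<forall>\<^sub>F z in nhds (?I x). (U has_derivative (\<lambda>h. G z \<bullet> h)) (at z)"
    and H: "(G has_derivative H) (at (?I x))"
    using U unfolding has_grad_hess_def by blast+
  have s: "s \<noteq> 0" using x by (simp add: s_def)
  have I: "(?I has_derivative DI) (at x)"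
    unfolding DI_def s_def using has_derivative_inversion[OF x] .
  have "filterlim ?I (nhds (?I x)) (nhds x)"
    using has_derivative_continuous[OF I] unfolding isCont_def continuous_within
    using tendsto_nhds_iff by blast
  then have "\<forall>\<^sub>F z in nhds x. (U has_derivative (\<lambda>h. G (?I z) \<bullet> h)) (at (?I z))"
    by (rule eventually_compose_filterlim[OF G])
  moreover have "\<forall>\<^sub>F z in nhds x. z \<noteq> 0"
    using x by (intro t1_space_nhds)
  ultimately have 1: "\<forall>\<^sub>F z in nhds x. ((\<lambda>z. U (?I z)) has_derivative
    (\<lambda>h. ((l / (z \<bullet> z)) *\<^sub>R G (?I z) - (2 * l / (z \<bullet> z)\<^sup>2 * (z \<bullet> G (?I z))) *\<^sub>R z) \<bullet> h)) (at z)"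
  proof eventually_elim
    case (elim z)
    show ?case
      by (rule has_derivative_eq_rhs[OF has_derivative_compose[OF has_derivative_inversion[OF elim(2)] elim(1)]])
         (simp add: fun_eq_iff inner_diff_left inner_diff_right inner_commute)
  qed
  have D: "((\<lambda>z. G (?I z)) has_derivative (\<lambda>h. H (DI h))) (at x)"
    by (rule has_derivative_compose[OF I H])
  have q: "((\<lambda>z. l / (z \<bullet> z)) has_derivative (\<lambda>h. - (2 * l * (x \<bullet> h) / s\<^sup>2))) (at x)"
    unfolding s_def using x
    by (auto intro!: derivative_eq_intros simp: fun_eq_iff inner_commute power2_eq_square field_simps)
  have q2: "((\<lambda>z. 2 * l / (z \<bullet> z)\<^sup>2) has_derivative (\<lambda>h. - (8 * l * (x \<bullet> h) / s ^ 3))) (at x)"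
    unfolding s_def using x
    by (auto intro!: derivative_eq_intros simp: fun_eq_iff inner_commute power2_eq_square power3_eq_cube field_simps)
  have ip: "((\<lambda>z. z \<bullet> G (?I z)) has_derivative (\<lambda>h. x \<bullet> H (DI h) + h \<bullet> g)) (at x)"
    unfolding g_def s_def by (rule has_derivative_inner[OF has_derivative_ident D])
  have 2: "((\<lambda>z. (l / (z \<bullet> z)) *\<^sub>R G (?I z)) has_derivative
      (\<lambda>h. (l / s) *\<^sub>R H (DI h) + (- (2 * l * (x \<bullet> h) / s\<^sup>2)) *\<^sub>R g)) (at x)"
    unfolding g_def s_def by (rule has_derivative_scaleR[OF q[unfolded s_def] D])
  have 3: "((\<lambda>z. (2 * l / (z \<bullet> z)\<^sup>2 * (z \<bullet> G (?I z))) *\<^sub>R z) has_derivative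
      (\<lambda>h. (2 * l / s\<^sup>2 * (x \<bullet> g)) *\<^sub>R h
        + (2 * l / s\<^sup>2 * (x \<bullet> H (DI h) + h \<bullet> g) + - (8 * l * (x \<bullet> h) / s ^ 3) * (x \<bullet> g)) *\<^sub>R x)) (at x)"
    using has_derivative_scaleR[OF has_derivative_mult[OF q2 ip] has_derivative_ident]
    unfolding g_def s_def .
  show ?thesis unfolding has_grad_hess_def using 1 has_derivative_diff[OF 2 3] by blast
qed

lemma trace_inversion:
  fixes x g :: "'a::euclidean_space" and l :: real
  assumes H: "linear H" and x: "x \<noteq> 0"
  defines "s \<equiv> x \<bullet> x"
  defines "DI \<equiv> \<lambda>h. (l / s) *\<^sub>R h - (2 * l * (x \<bullet> h) / s\<^sup>2) *\<^sub>R x"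
  shows "(\<Sum>b\<in>Basis. (((l / s) *\<^sub>R H (DI b) + (- (2 * l * (x \<bullet> b) / s\<^sup>2)) *\<^sub>R g)
      - ((2 * l / s\<^sup>2 * (x \<bullet> g)) *\<^sub>R b
        + (2 * l / s\<^sup>2 * (x \<bullet> H (DI b) + b \<bullet> g) + - (8 * l * (x \<bullet> b) / s ^ 3) * (x \<bullet> g)) *\<^sub>R x)) \<bullet> b)
    = (l / s)\<^sup>2 * (\<Sum>b\<in>Basis. H b \<bullet> b) - (2 * real DIM('a) - 4) * (l / s\<^sup>2) * (x \<bullet> g)"
    (is "(\<Sum>b\<in>Basis. ?t b) = _")
proof -
  have s: "s > 0" using x by (simp add: s_def)
  have HDI: "H (DI b) = (l / s) *\<^sub>R H b - (2 * l * (x \<bullet> b) / s\<^sup>2) *\<^sub>R H x" for b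
    by (simp add: DI_def linear_diff[OF H] linear_scale[OF H])
  \<comment> \<open>Expansion of \<open>x\<close> in the basis; symmetry of the Hessian is not used.\<close>
  have xH: "(\<Sum>b\<in>Basis. (x \<bullet> H b) * (x \<bullet> b)) = x \<bullet> H x"
  proof -
    have "x \<bullet> H x = x \<bullet> H (\<Sum>b\<in>Basis. (x \<bullet> b) *\<^sub>R b)"
      by (simp add: euclidean_representation)
    also have "\<dots> = (\<Sum>b\<in>Basis. (x \<bullet> H b) * (x \<bullet> b))"
      by (simp add: linear_sum[OF H] linear_scale[OF H] inner_sum_right mult.commute)
    finally show ?thesis by simp
  qed
  have "?t b = (l / s)\<^sup>2 * (H b \<bullet> b) - (2 * l\<^sup>2 / s ^ 3) * ((x \<bullet> b) * (H x \<bullet> b))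
      - (4 * l / s\<^sup>2) * ((x \<bullet> b) * (g \<bullet> b)) - (2 * l / s\<^sup>2) * (x \<bullet> g)
      - (2 * l\<^sup>2 / s ^ 3) * ((x \<bullet> H b) * (x \<bullet> b))
      + ((4 * l\<^sup>2 / s ^ 4) * (x \<bullet> H x) + (8 * l / s ^ 3) * (x \<bullet> g)) * ((x \<bullet> b) * (x \<bullet> b))"
    if "b \<in> Basis" for b
    using s that
    by (simp add: HDI inner_add_left inner_diff_left inner_diff_right inner_commute[of b g]
        power2_eq_square power3_eq_cube power4_eq_xxxx field_simps)
  then have "(\<Sum>b\<in>Basis. ?t b) = (l / s)\<^sup>2 * (\<Sum>b\<in>Basis. H b \<bullet> b) - (2 * l\<^sup>2 / s ^ 3) * (x \<bullet> H x)
      - (4 * l / s\<^sup>2) * (x \<bullet> g) - DIM('a) * ((2 * l / s\<^sup>2) * (x \<bullet> g))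
      - (2 * l\<^sup>2 / s ^ 3) * (x \<bullet> H x)
      + ((4 * l\<^sup>2 / s ^ 4) * (x \<bullet> H x) + (8 * l / s ^ 3) * (x \<bullet> g)) * s"
    by (simp add: sum.distrib sum_subtractf sum_distrib_left[symmetric] sum_divide_distrib[symmetric]
        sum_Basis_inner_mult xH s_def)
  also have "\<dots> = (l / s)\<^sup>2 * (\<Sum>b\<in>Basis. H b \<bullet> b) - (2 * real DIM('a) - 4) * (l / s\<^sup>2) * (x \<bullet> g)"
    using s by (simp add: power2_eq_square power3_eq_cube power4_eq_xxxx field_simps)
  finally show ?thesis .
qed

text \<open>The weight \<open>|z| powr (2 - N)\<close> is harmonic, and the first-order terms produced by the inversion cancel
  against the cross term of the product rule for exactly this weight.\<close>

lemma has_laplacian_kelvin0: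
  fixes x :: "'a::euclidean_space" and U :: "'a \<Rightarrow> real"
  assumes U: "has_laplacian U L ((l / (x \<bullet> x)) *\<^sub>R x)" and x: "x \<noteq> 0"
  defines "q \<equiv> 2 - real DIM('a)"
  shows "has_laplacian (\<lambda>z. norm z powr q * U ((l / (z \<bullet> z)) *\<^sub>R z))
    (norm x powr q * ((l / (x \<bullet> x))\<^sup>2 * L)) x"
proof -
  let ?I = "(l / (x \<bullet> x)) *\<^sub>R x"
  obtain G H where gh: "has_grad_hess U G H ?I" and L: "L = (\<Sum>b\<in>Basis. H b \<bullet> b)"
    using U unfolding has_laplacian_def by blast
  then have H: "linear H" unfolding has_grad_hess_def using has_derivative_linear by blast
  have n: "norm x powr (q - 2) * (x \<bullet> x) = norm x powr q"
    using x by (simp add: power2_norm_eq_inner[symmetric] powr_add[symmetric] powr_numeral[symmetric] del: powr_numeral)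
  let ?s = "x \<bullet> x" and ?g = "G ?I"
  have s: "?s > 0" using x by simp
  have cross: "((q * norm x powr (q - 2)) *\<^sub>R x) \<bullet> ((l / ?s) *\<^sub>R ?g - (2 * l / ?s\<^sup>2 * (x \<bullet> ?g)) *\<^sub>R x)
    = - q * (norm x powr q) * (l / ?s\<^sup>2) * (x \<bullet> ?g)"
    unfolding n[symmetric] using s by (simp add: inner_diff_right power2_eq_square field_simps)
  have "has_laplacian (\<lambda>z. norm z powr q * U ((l / (z \<bullet> z)) *\<^sub>R z))
      (norm x powr q * ((l / ?s)\<^sup>2 * L - (2 * real DIM('a) - 4) * (l / ?s\<^sup>2) * (x \<bullet> ?g))
        + 2 * (- q * (norm x powr q) * (l / ?s\<^sup>2) * (x \<bullet> ?g))
        + U ?I * (q * (q + DIM('a) - 2) * norm x powr (q - 2))) x"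
    using laplacian_mult[OF has_grad_hess_norm_powr[OF x] has_grad_hess_inversion[OF gh x], of q]
    unfolding trace_norm_powr[OF x] trace_inversion[OF H x, of l "?g"] cross L .
  moreover have "norm x powr q * ((l / ?s)\<^sup>2 * L - (2 * real DIM('a) - 4) * (l / ?s\<^sup>2) * (x \<bullet> ?g))
        + 2 * (- q * (norm x powr q) * (l / ?s\<^sup>2) * (x \<bullet> ?g))
        + U ?I * (q * (q + DIM('a) - 2) * norm x powr (q - 2)) = norm x powr q * ((l / ?s)\<^sup>2 * L)"
    by (simp add: q_def algebra_simps)
  ultimately show ?thesis by simp
qed

text \<open>The Kelvin transform of \<open>w\<close> with respect to the sphere of radius \<open>l\<close> about \<open>y\<close>. The value at
  \<open>y\<close> itself is irrelevant, and \<open>l = 0\<close> gives the zero function in dimension at least three.\<close>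

definition kelvin :: "'a \<Rightarrow> real \<Rightarrow> ('a::euclidean_space \<Rightarrow> real) \<Rightarrow> 'a \<Rightarrow> real" where
  "kelvin y l w x =
     (l / norm (x - y)) ^ (DIM('a) - 2) * w (y + (l / norm (x - y))\<^sup>2 *\<^sub>R (x - y))"

lemma has_laplacian_kelvin:
  fixes w :: "'a::euclidean_space \<Rightarrow> real"
  assumes w: "has_laplacian w L (y + (l / norm (x - y))\<^sup>2 *\<^sub>R (x - y))"
    and x: "x \<noteq> y" and l: "l > 0" and dim: "DIM('a) \<ge> 2"
  shows "has_laplacian (kelvin y l w) ((l / norm (x - y)) ^ (DIM('a) + 2) * L) x"
proof -
  define q where "q = 2 - real DIM('a)"
  define n where "n = DIM('a) - 2"
  have qn: "q = - real n" and Dn: "DIM('a) = n + 2" using dim by (auto simp: q_def n_def)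
  have sq: "(l / norm z)\<^sup>2 = l\<^sup>2 / (z \<bullet> z)" for z :: 'a
    by (simp add: power_divide power2_norm_eq_inner)
  have pw: "l ^ n * norm z powr q = (l / norm z) ^ n" if "z \<noteq> 0" for z :: 'a
    using that by (simp add: qn powr_minus powr_realpow power_mult_distrib power_inverse divide_inverse)
  let ?x = "x - y"
  have "has_laplacian (\<lambda>z. w (z + y)) L ((l\<^sup>2 / (?x \<bullet> ?x)) *\<^sub>R ?x)"
    using has_laplacian_translate[OF w, of "- y"] by (simp add: sq add.commute)
  from has_laplacian_kelvin0[OF this, folded q_def] x
  have "has_laplacian (\<lambda>z. norm z powr q * w ((l\<^sup>2 / (z \<bullet> z)) *\<^sub>R z + y))
      (norm ?x powr q * ((l\<^sup>2 / (?x \<bullet> ?x))\<^sup>2 * L)) ?x" by simp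
  from has_laplacian_cmult[OF has_laplacian_translate[OF this, of y], of "l ^ n"]
  have "has_laplacian (\<lambda>z. l ^ n * (norm (z - y) powr q * w ((l\<^sup>2 / ((z - y) \<bullet> (z - y))) *\<^sub>R (z - y) + y)))
      (l ^ n * (norm ?x powr q * ((l\<^sup>2 / (?x \<bullet> ?x))\<^sup>2 * L))) x"
    by simp
  moreover have "\<forall>\<^sub>F z in nhds x. l ^ n * (norm (z - y) powr q * w ((l\<^sup>2 / ((z - y) \<bullet> (z - y))) *\<^sub>R (z - y) + y))
      = kelvin y l w z"
    using t1_space_nhds[OF x]
    by eventually_elim (simp add: kelvin_def n_def[symmetric] pw[symmetric] sq[symmetric] add.commute)
  ultimately have "has_laplacian (kelvin y l w) (l ^ n * (norm ?x powr q * ((l\<^sup>2 / (?x \<bullet> ?x))\<^sup>2 * L))) x"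
    by (rule has_laplacian_cong)
  moreover have "(l / norm ?x) ^ (DIM('a) + 2) = (l / norm ?x) ^ n * ((l / norm ?x)\<^sup>2)\<^sup>2"
  proof -
    have "DIM('a) + 2 = n + 2 * 2" by (simp add: Dn)
    then show ?thesis by (simp only: power_add power_mult)
  qed
  then have "l ^ n * (norm ?x powr q * ((l\<^sup>2 / (?x \<bullet> ?x))\<^sup>2 * L)) = (l / norm ?x) ^ (DIM('a) + 2) * L"
    using x by (simp only: mult.assoc[symmetric] sq[symmetric] pw[of ?x] right_minus_eq not_False_eq_True)
  ultimately show ?thesis by simp
qed

section \<open>Minimum principles\<close>

text \<open>Weak minimum principle. Each point of the compact set either already satisfies the claim
  (this covers the boundary) or is an interior point where \<open>f\<close> is superharmonic.\<close>

lemma min_principle: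
  fixes f :: "'a::euclidean_space \<Rightarrow> real"
  assumes K: "compact K" and cont: "continuous_on K f"
    and alt: "\<And>x. x \<in> K \<Longrightarrow> f x \<ge> 0 \<or> (x \<in> interior K \<and> (\<exists>L\<le>0. has_laplacian f L x))"
    and x: "x \<in> K"
  shows "f x \<ge> 0"
proof (rule ccontr)
  assume neg: "\<not> f x \<ge> 0"
  obtain R where R: "R > 0" "\<And>z. z \<in> K \<Longrightarrow> norm z \<le> R"
    using compact_imp_bounded[OF K] bounded_pos by blast
  define e where "e = - f x / (2 * R\<^sup>2)"
  have e: "e > 0" "e * R\<^sup>2 = - f x / 2" using neg R(1) by (auto simp: e_def field_simps)
  \<comment> \<open>The perturbation makes the Laplacian strictly negative and moves \<open>f\<close> too little to lose the negative value.\<close>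
  define g where "g z = f z + e * (R\<^sup>2 - (norm (z - 0))\<^sup>2)" for z
  have "continuous_on K g" unfolding g_def by (intro continuous_intros cont)
  then obtain z where z: "z \<in> K" "\<And>w. w \<in> K \<Longrightarrow> g z \<le> g w"
    using continuous_attains_inf[OF K, of g] x by blast
  have fg: "f w \<le> g w" if "w \<in> K" for w
    using R(2)[OF that] e(1) by (simp add: g_def power_mono)
  have "g x \<le> f x + e * R\<^sup>2"
    using e(1) by (simp add: g_def)
  then have "f z < 0" using fg[OF z(1)] z(2)[OF x] e(2) neg by linarith
  with alt[OF z(1)] obtain L where L: "z \<in> interior K" "L \<le> 0" "has_laplacian f L z" by auto
  have "has_laplacian g (L + e * (0 - real (2 * DIM('a)))) z"
    unfolding g_def
    by (intro has_laplacian_add has_laplacian_cmult has_laplacian_diff has_laplacian_const has_laplacian_sq L)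
  moreover have "\<forall>\<^sub>F w in nhds z. g z \<le> g w"
    using eventually_nhds_in_open[OF open_interior L(1)]
    by eventually_elim (use interior_subset z(2) in blast)
  ultimately have "0 \<le> L + e * (0 - real (2 * DIM('a)))" by (rule has_laplacian_local_min)
  moreover have "e * real (2 * DIM('a)) > 0" using e(1) by simp
  ultimately show False using L(2) by simp
qed

text \<open>The origin is a removable boundary point for functions that are not too negative there compared
  with the fundamental solution \<open>|x| powr (2 - N)\<close>.\<close>

lemma punctured_min_principle:
  fixes f :: "'a::euclidean_space \<Rightarrow> real"
  assumes K: "compact K" and cont: "continuous_on (K - {0}) f"
    and alt: "\<And>x. x \<in> K \<Longrightarrow> x \<noteq> 0 \<Longrightarrow>
      f x \<ge> 0 \<or> (x \<in> interior K \<and> (\<exists>L\<le>0. has_laplacian f L x))"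
    and growth: "\<And>e. e > 0 \<Longrightarrow>
      \<exists>r>0. \<forall>x\<in>K. 0 < norm x \<and> norm x \<le> r \<longrightarrow> 0 \<le> f x + e * norm x powr (2 - real DIM('a))"
    and x: "x \<in> K" "x \<noteq> 0"
  shows "f x \<ge> 0"
proof -
  define q where "q = 2 - real DIM('a)"
  have eps: "f x + e * norm x powr q \<ge> 0" if e: "e > 0" for e
  proof -
    obtain r where r: "r > 0" "\<And>x. x \<in> K \<Longrightarrow> 0 < norm x \<Longrightarrow> norm x \<le> r \<Longrightarrow> 0 \<le> f x + e * norm x powr q"
      using growth[OF e] unfolding q_def by blast
    show ?thesis
    proof (cases "norm x \<le> r")
      case True then show ?thesis using r(2) x by simp
    next
      case False
      define A where "A = K \<inter> {z. norm z \<ge> r}"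
      have "compact A" unfolding A_def
        by (intro compact_Int_closed K closed_Collect_le continuous_intros)
      moreover have A0: "z \<in> A \<Longrightarrow> z \<in> K - {0}" for z using r(1) by (auto simp: A_def)
      then have "continuous_on A f" using cont by (meson continuous_on_subset subsetI)
      then have "continuous_on A (\<lambda>z. f z + e * norm (z - 0) powr q)"
        using A0 by (intro continuous_intros) auto
      moreover have "0 \<le> f z + e * norm (z - 0) powr q \<or>
         z \<in> interior A \<and> (\<exists>L\<le>0. has_laplacian (\<lambda>z. f z + e * norm (z - 0) powr q) L z)" if z: "z \<in> A" for z
      proof (cases "f z \<ge> 0 \<or> norm z = r")
        case True
        then show ?thesis using e r(1) r(2)[of z] z by (auto simp: A_def)
      next
        case False
        with alt[of z] A0[OF z] obtain L where L: "z \<in> interior K" "L \<le> 0" "has_laplacian f L z" by auto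
        have "has_laplacian (\<lambda>z. f z + e * norm (z - 0) powr q)
           (L + e * (q * (q + DIM('a) - 2) * norm (z - 0) powr (q - 2))) z"
          using A0[OF z] by (intro has_laplacian_add has_laplacian_cmult has_laplacian_norm_powr L) auto
        moreover have "z \<in> interior A"
          unfolding A_def interior_Int
        proof
          have "open {z::'a. norm z > r}" by (intro open_Collect_less continuous_intros)
          moreover have "z \<in> {z. norm z > r}" using z False by (auto simp: A_def)
          ultimately show "z \<in> interior {z. r \<le> norm z}"
            by (intro interiorI[of "{z. norm z > r}"]) auto
        qed (rule L)
        ultimately show ?thesis using L(2) by (auto simp: q_def)
      qed
      moreover have "x \<in> A" using x False by (simp add: A_def)
      ultimately have "0 \<le> f x + e * norm (x - 0) powr q" by (rule min_principle)
      then show ?thesis by simp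
    qed
  qed
  have pos: "0 \<le> f x + (e / norm x powr q) * norm x powr q" if "e > 0" for e
    using eps[of "e / norm x powr q"] that x by simp
  show ?thesis
  proof (rule field_le_epsilon)
    show "0 \<le> f x + e" if "e > 0" for e
      using pos[OF that] x by simp
  qed
qed

lemma punctured_min_principle_powr:
  fixes f :: "'a::euclidean_space \<Rightarrow> real"
  assumes K: "compact K" and cont: "continuous_on (K - {0}) f"
    and alt: "\<And>x. x \<in> K \<Longrightarrow> x \<noteq> 0 \<Longrightarrow>
      f x \<ge> 0 \<or> (x \<in> interior K \<and> (\<exists>L\<le>0. has_laplacian f L x))"
    and p: "p > 2 - real DIM('a)"
    and growth: "\<And>x. x \<in> K \<Longrightarrow> x \<noteq> 0 \<Longrightarrow> - B * norm x powr p \<le> f x"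
    and x: "x \<in> K" "x \<noteq> 0"
  shows "f x \<ge> 0"
proof (rule punctured_min_principle[OF K cont alt _ x])
  fix e :: real assume e: "e > 0"
  define d where "d = p - (2 - real DIM('a))"
  define r where "r = (e / (\<bar>B\<bar> + 1)) powr (1 / d)"
  have d: "d > 0" using p by (simp add: d_def)
  have r: "r > 0" using e by (simp add: r_def)
  have rd: "r powr d = e / (\<bar>B\<bar> + 1)" using d e by (simp add: r_def powr_powr)
  show "\<exists>r>0. \<forall>x\<in>K. 0 < norm x \<and> norm x \<le> r \<longrightarrow> 0 \<le> f x + e * norm x powr (2 - real DIM('a))"
  proof (intro exI[of _ r] conjI r ballI impI)
    fix x assume x: "x \<in> K" "0 < norm x \<and> norm x \<le> r"
    have "norm x powr d \<le> e / (\<bar>B\<bar> + 1)"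
      using x d unfolding rd[symmetric] by (intro powr_mono2) auto
    then have "(\<bar>B\<bar> + 1) * norm x powr d \<le> e" by (simp add: field_simps)
    moreover have "B * norm x powr d \<le> (\<bar>B\<bar> + 1) * norm x powr d" by (intro mult_right_mono) auto
    ultimately have "B * norm x powr d * norm x powr (2 - real DIM('a)) \<le> e * norm x powr (2 - real DIM('a))"
      by (intro mult_right_mono) auto
    also have "B * norm x powr d * norm x powr (2 - real DIM('a)) = B * norm x powr p"
      by (simp add: d_def powr_add[symmetric] mult.assoc)
    finally show "0 \<le> f x + e * norm x powr (2 - real DIM('a))"
      using growth[of x] x by auto
  qed
qed

section \<open>Positive solutions of the system\<close>

text \<open>A positive solution of the system in dimension \<open>N = k + 2\<close>. With \<open>a = 2 / k\<close> the exponents are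
  \<open>2\<^sup>* - 1 = 1 + 2 a\<close>, \<open>2\<^sup>* / 2 - 1 = a\<close> and \<open>2\<^sup>* / 2 = 1 + a\<close>; the hypothesis \<open>N \<ge> 4\<close> becomes \<open>a \<le> 1\<close>.\<close>

locale positive_pair =
  fixes u v :: "'a::euclidean_space \<Rightarrow> real" and k :: nat and \<mu>1 \<mu>2 \<beta> a :: real
  assumes dim: "DIM('a) = k + 2" and k: "k \<ge> 2" and a: "a = 2 / real k"
    and coeff: "\<mu>1 > 0" "\<mu>2 > 0" "\<beta> > 0"
    and C2: "Ck_on 2 (ball 0 2 - {0}) u" "Ck_on 2 (ball 0 2 - {0}) v"
    and pos: "\<And>x. x \<in> ball 0 2 - {0} \<Longrightarrow> u x > 0" "\<And>x. x \<in> ball 0 2 - {0} \<Longrightarrow> v x > 0"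
    and eqn: "\<And>x. x \<in> ball 0 2 - {0} \<Longrightarrow>
        - laplacian u x = \<mu>1 * u x powr (1 + 2 * a) + \<beta> * u x powr a * v x powr (1 + a)"
      "\<And>x. x \<in> ball 0 2 - {0} \<Longrightarrow>
        - laplacian v x = \<mu>2 * v x powr (1 + 2 * a) + \<beta> * v x powr a * u x powr (1 + a)"
begin

text \<open>The punctured ball of the equations, and the smaller punctured closed ball used for all estimates.\<close>

definition \<Omega> :: "'a set" where "\<Omega> = ball 0 2 - {0}"
definition D :: "'a set" where "D = cball 0 1 - {0}"

text \<open>The right-hand side of the equation for a component \<open>s\<close> with partner \<open>t\<close>. It is increasing in
  both arguments (the system is cooperative) and homogeneous of the conformal degree \<open>(N + 2) / (N - 2)\<close>.\<close>

definition reaction :: "real \<Rightarrow> real \<Rightarrow> real \<Rightarrow> real" where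
  "reaction \<mu> s t = \<mu> * s powr (1 + 2 * a) + \<beta> * s powr a * t powr (1 + a)"

lemma swap: "positive_pair v u k \<mu>2 \<mu>1 \<beta> a"
  using positive_pair_axioms unfolding positive_pair_def by auto

lemma open_\<Omega>: "open \<Omega>" by (simp add: \<Omega>_def open_delete)

lemma D_subset: "D \<subseteq> \<Omega>" by (auto simp: D_def \<Omega>_def)

lemma a_bounds: "0 < a" "a \<le> 1" using k by (auto simp: a)

lemma reaction_nonneg: "\<mu> \<ge> 0 \<Longrightarrow> reaction \<mu> s t \<ge> 0"
  using coeff by (simp add: reaction_def)

lemma reaction_mono:
  assumes "\<mu> \<ge> 0" "0 \<le> s" "s \<le> s'" "0 \<le> t" "t \<le> t'"
  shows "reaction \<mu> s t \<le> reaction \<mu> s' t'"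
  unfolding reaction_def using assms coeff a_bounds
  by (intro add_mono mult_mono mult_left_mono powr_mono2) auto

lemma reaction_scale:
  assumes "c > 0" "s > 0" "t > 0"
  shows "reaction \<mu> (c ^ k * s) (c ^ k * t) = c ^ (k + 4) * reaction \<mu> s t"
proof -
  have k0: "real k > 0" using k by simp
  have p: "(c ^ k * s) powr e = c powr (k * e) * s powr e" if "s > 0" for s e :: real
    using assms(1) that by (simp add: powr_mult powr_powr powr_realpow[symmetric])
  have c: "c ^ (k + 4) = c powr (k + 4)" using assms(1) powr_realpow[of c "k + 4"] by simp
  have e1: "real k * (1 + 2 * a) = k + 4" using k0 by (simp add: a field_simps)
  have "real k * a + real k * (1 + a) = k + 4" using k0 by (simp add: a field_simps)
  then have e2: "c powr (real k * a) * c powr (real k * (1 + a)) = c powr (k + 4)"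
    by (simp add: powr_add[symmetric])
  show ?thesis unfolding reaction_def p[OF assms(2)] p[OF assms(3)] c e1 e2[symmetric]
    using e2 by (simp add: algebra_simps)
qed

lemma lap:
  assumes "x \<in> \<Omega>"
  shows "has_laplacian u (- reaction \<mu>1 (u x) (v x)) x" "has_laplacian v (- reaction \<mu>2 (v x) (u x)) x"
proof -
  have "laplacian u x = - reaction \<mu>1 (u x) (v x)" "laplacian v x = - reaction \<mu>2 (v x) (u x)"
    using eqn[of x] assms unfolding \<Omega>_def reaction_def by auto
  then show "has_laplacian u (- reaction \<mu>1 (u x) (v x)) x" "has_laplacian v (- reaction \<mu>2 (v x) (u x)) x"
    using Ck_on_2D(3)[OF C2(1)[folded \<Omega>_def] open_\<Omega> assms]
      Ck_on_2D(3)[OF C2(2)[folded \<Omega>_def] open_\<Omega> assms] by simp_all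
qed

lemma positive: "w = u \<or> w = v \<Longrightarrow> x \<in> \<Omega> \<Longrightarrow> w x > 0"
  using pos \<Omega>_def by blast

lemma der: "w = u \<or> w = v \<Longrightarrow> x \<in> \<Omega> \<Longrightarrow> (w has_derivative (\<lambda>h. grad w x \<bullet> h)) (at x)"
  using Ck_on_2D(1) C2 open_\<Omega> \<Omega>_def by metis

lemma cont_grad: "w = u \<or> w = v \<Longrightarrow> x \<in> \<Omega> \<Longrightarrow> isCont (grad w) x"
  using Ck_on_2D(2) C2 open_\<Omega> \<Omega>_def by metis

lemma cont: "w = u \<or> w = v \<Longrightarrow> A \<subseteq> \<Omega> \<Longrightarrow> continuous_on A w"
  by (meson continuous_at_imp_continuous_on der has_derivative_continuous subsetD)

lemma superharmonic: "w = u \<or> w = v \<Longrightarrow> x \<in> \<Omega> \<Longrightarrow> \<exists>L\<le>0. has_laplacian w L x"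
  using lap reaction_nonneg coeff by (metis neg_le_0_iff_le less_imp_le)

text \<open>By the minimum principle on the punctured unit ball, both components are at least their minimum
  on the unit sphere.\<close>

lemma lower_bound:
  obtains m where "m > 0" "\<And>w x. w = u \<or> w = v \<Longrightarrow> x \<in> D \<Longrightarrow> m \<le> w x"
proof -
  have ex: "\<exists>m>0. \<forall>x\<in>D. m \<le> w x" if w: "w = u \<or> w = v" for w
  proof -
    have sub: "sphere 0 1 \<subseteq> \<Omega>" by (auto simp: \<Omega>_def)
    moreover have "sphere (0::'a) 1 \<noteq> {}" by simp
    ultimately obtain z where z: "z \<in> sphere 0 1" "\<And>x. x \<in> sphere 0 1 \<Longrightarrow> w z \<le> w x"
      using continuous_attains_inf[OF compact_sphere _ cont[OF w sub]] by blast
    have wz: "w z > 0" using positive[OF w] z sub by blast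
    have "w z \<le> w x" if x: "x \<in> D" for x
    proof -
      have "0 \<le> w x - w z"
      proof (rule punctured_min_principle_powr[of "cball 0 1" "\<lambda>x. w x - w z" 0 "w z"])
        show "continuous_on (cball 0 1 - {0}) (\<lambda>x. w x - w z)"
          using cont[OF w D_subset] by (auto simp: D_def intro: continuous_intros)
        show "0 \<le> w x - w z \<or> x \<in> interior (cball 0 1) \<and> (\<exists>L\<le>0. has_laplacian (\<lambda>x. w x - w z) L x)"
          if "x \<in> cball 0 1" "x \<noteq> 0" for x
        proof (cases "norm x = 1")
          case False
          then have "x \<in> interior (cball 0 1)" using that by (simp add: interior_cball)
          moreover have "x \<in> \<Omega>" using that by (auto simp: \<Omega>_def)
          then obtain L where "L \<le> 0" "has_laplacian w L x" using superharmonic[OF w] by blast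
          ultimately show ?thesis using has_laplacian_diff[OF _ has_laplacian_const] by fastforce
        qed (use z(2) in auto)
        show "- w z * norm x powr 0 \<le> w x - w z" if "x \<in> cball 0 1" "x \<noteq> 0" for x
          using positive[OF w, of x] that by (auto simp: \<Omega>_def)
      qed (use x k dim in \<open>auto simp: D_def\<close>)
      then show ?thesis by simp
    qed
    then show ?thesis using wz by blast
  qed
  obtain m1 m2 where "m1 > 0" "\<forall>x\<in>D. m1 \<le> u x" "m2 > 0" "\<forall>x\<in>D. m2 \<le> v x"
    using ex[of u] ex[of v] by blast
  then show ?thesis by (intro that[of "min m1 m2"]) (auto simp: min_def)
qed

end

section \<open>Moving spheres\<close>

text \<open>The Kelvin transform as a function of the radius and of the inverted point, which varies in a
  compact set; this gives the uniform continuity in the radius that the continuation argument uses.\<close>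

lemma kelvin_eq:
  fixes x y :: "'a::euclidean_space"
  shows "kelvin y l w x = (l * norm ((1 / (norm (x - y))\<^sup>2) *\<^sub>R (x - y))) ^ (DIM('a) - 2)
      * w (y + l\<^sup>2 *\<^sub>R ((1 / (norm (x - y))\<^sup>2) *\<^sub>R (x - y)))"
proof -
  have "norm ((1 / (norm (x - y))\<^sup>2) *\<^sub>R (x - y)) = 1 / norm (x - y)"
    by (simp add: power2_eq_square)
  then show ?thesis by (simp add: kelvin_def power_divide)
qed

text \<open>The data for moving spheres about a centre \<open>y \<noteq> 0\<close> with radii up to \<open>R\<close>, all of which leave the
  singularity outside. On the unit sphere, which is at distance at least \<open>1 / 2\<close> from \<open>y\<close>, the last
  assumption bounds the Kelvin transforms by \<open>m / 2\<close>, half of the lower bound for \<open>u\<close> and \<open>v\<close>.\<close>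

locale sphere_setup = positive_pair u v k \<mu>1 \<mu>2 \<beta> a
  for u v :: "'a::euclidean_space \<Rightarrow> real" and k :: nat and \<mu>1 \<mu>2 \<beta> a :: real +
  fixes m S R :: real and y :: 'a
  assumes m: "m > 0" and m_le: "\<And>w x. w = u \<or> w = v \<Longrightarrow> x \<in> D \<Longrightarrow> m \<le> w x"
    and R: "0 < R" "R < norm y" and y: "norm y \<le> 1 / 2"
    and S: "\<And>w x. w = u \<or> w = v \<Longrightarrow> x \<in> cball y R \<Longrightarrow> w x \<le> S"
    and RS: "(2 * R) ^ k * S \<le> m / 2"
begin

text \<open>The Kelvin transforms of both components about the sphere of radius \<open>l\<close> lie below the
  components, outside of this sphere.\<close>

definition below :: "real \<Rightarrow> bool" where
  "below l \<longleftrightarrow> (\<forall>w x. (w = u \<or> w = v) \<longrightarrow> x \<in> D \<longrightarrow> l \<le> norm (x - y) \<longrightarrow> kelvin y l w x \<le> w x)"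

lemma k1: "DIM('a) - 2 = k" "k \<ge> 1" "k > 0" using dim k by auto

lemma cball_D: "cball y R \<subseteq> D"
proof
  fix x assume "x \<in> cball y R"
  then have "norm (x - y) \<le> R" by (simp add: dist_norm norm_minus_commute)
  then show "x \<in> D" using R y norm_triangle_ineq2[of y x] norm_triangle_ineq2[of x y]
    unfolding D_def by (auto simp: norm_minus_commute)
qed

lemma cball_\<Omega>: "cball y R \<subseteq> \<Omega>" using cball_D D_subset by blast

lemma reflect_mem:
  assumes "0 < l" "l \<le> R" "l \<le> norm (x - y)"
  shows "y + (l / norm (x - y))\<^sup>2 *\<^sub>R (x - y) \<in> cball y R"
proof -
  have "l / norm (x - y) \<le> 1" using assms by (subst divide_le_eq_1_pos) linarith+
  then have "(l / norm (x - y)) * l \<le> 1 * R" using assms by (intro mult_mono) auto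
  then show ?thesis using assms by (simp add: dist_norm power2_eq_square)
qed

lemma kelvin_shift: "kelvin y l (\<lambda>z. w z - c) x = kelvin y l w x - c * (l / norm (x - y)) ^ k"
  by (simp add: kelvin_def k1 algebra_simps)

lemma cont_kelvin:
  assumes w: "w = u \<or> w = v" and l: "0 < l" "l \<le> R"
  shows "continuous_on (- ball y l) (kelvin y l w)"
proof -
  have "continuous_on (- ball y l) (\<lambda>x. w (y + (l / norm (x - y))\<^sup>2 *\<^sub>R (x - y)))"
    using l by (intro continuous_on_compose2[OF cont[OF w cball_\<Omega>]] continuous_intros)
      (auto simp: dist_norm norm_minus_commute intro: reflect_mem)
  then show ?thesis
    unfolding kelvin_def using l by (intro continuous_intros) auto
qed

lemma lap_kelvin:
  assumes l: "0 < l" "l \<le> R" "l \<le> norm (x - y)" and \<mu>: "\<mu> \<ge> 0"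
    and eq: "\<And>z. z \<in> \<Omega> \<Longrightarrow> has_laplacian w (- reaction \<mu> (w z) (w' z)) z"
    and ww': "w = u \<and> w' = v \<or> w = v \<and> w' = u"
  shows "has_laplacian (kelvin y l (\<lambda>z. w z - c)) (- reaction \<mu> (kelvin y l w x) (kelvin y l w' x)) x"
proof -
  let ?p = "y + (l / norm (x - y))\<^sup>2 *\<^sub>R (x - y)"
  have p: "?p \<in> \<Omega>" using reflect_mem[OF l] cball_\<Omega> by blast
  have "has_laplacian (\<lambda>z. w z - c) (- reaction \<mu> (w ?p) (w' ?p)) ?p"
    using has_laplacian_diff[OF eq[OF p] has_laplacian_const] by simp
  moreover have "x \<noteq> y" "DIM('a) \<ge> 2" using l dim by auto
  ultimately have "has_laplacian (kelvin y l (\<lambda>z. w z - c))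
      ((l / norm (x - y)) ^ (DIM('a) + 2) * - reaction \<mu> (w ?p) (w' ?p)) x"
    using l(1) by (intro has_laplacian_kelvin)
  moreover have "(l / norm (x - y)) ^ (DIM('a) + 2) * - reaction \<mu> (w ?p) (w' ?p)
      = - reaction \<mu> (kelvin y l w x) (kelvin y l w' x)"
  proof -
    have "l / norm (x - y) > 0" using l by (intro divide_pos_pos) linarith+
    moreover have "w ?p > 0" "w' ?p > 0" using positive p ww' by blast+
    moreover have "DIM('a) + 2 = k + 4" using dim by simp
    ultimately show ?thesis unfolding kelvin_def k1 by (simp only: reaction_scale mult_minus_right)
  qed
  ultimately show ?thesis by simp
qed

lemma kelvin_pos:
  assumes w: "w = u \<or> w = v" and l: "0 < l" "l \<le> R" "l \<le> norm (x - y)"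
  shows "0 < kelvin y l w x"
proof -
  have "0 < w (y + (l / norm (x - y))\<^sup>2 *\<^sub>R (x - y))"
    using positive[OF w] reflect_mem[OF l] cball_\<Omega> by blast
  then show ?thesis unfolding kelvin_def using l by (intro mult_pos_pos zero_less_power divide_pos_pos) linarith+
qed

text \<open>If the comparison holds for \<open>u\<close> and \<open>v\<close>, it holds for \<open>u - m / 2\<close> and \<open>v - m / 2\<close>: the difference
  \<open>f\<close> of the shifted function and its transform is superharmonic because the system is cooperative,
  vanishes on the sphere of radius \<open>l\<close>, and is nonnegative on the unit sphere. Since the transform of the
  constant is \<open>m / 2 * (l / |x - y|)\<^sup>k\<close>, this is a quantitative strict inequality. It replaces both the
  strong maximum principle and the Hopf lemma.\<close>

lemma below_improve:
  assumes l: "0 < l" "l \<le> R" and b: "below l" and w: "w = u \<or> w = v"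
    and x: "x \<in> D" "l \<le> norm (x - y)"
  shows "kelvin y l (\<lambda>z. w z - m / 2) x \<le> w x - m / 2"
proof -
  define w' where "w' z = w z - m / 2" for z
  define \<mu> where "\<mu> = (if w = u then \<mu>1 else \<mu>2)"
  define w2 where "w2 = (if w = u then v else u)"
  have \<mu>0: "\<mu> \<ge> 0" using coeff by (simp add: \<mu>_def)
  have ww2: "w = u \<and> w2 = v \<or> w = v \<and> w2 = u" "w2 = u \<or> w2 = v" using w by (auto simp: w2_def)
  have eq: "has_laplacian w (- reaction \<mu> (w z) (w2 z)) z" if "z \<in> \<Omega>" for z
    using lap[OF that] w by (auto simp: \<mu>_def w2_def)
  let ?K = "cball 0 1 - ball y l"
  let ?f = "\<lambda>z. w' z - kelvin y l w' z"
  have f: "?f z = w z - kelvin y l w z - m / 2 * (1 - (l / norm (z - y)) ^ k)" for z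
    unfolding w'_def[abs_def] kelvin_shift by (simp add: algebra_simps)
  have "0 \<le> ?f x"
  proof (rule punctured_min_principle_powr[where K = ?K and f = ?f and p = 0 and B = "m / 2"])
    show "compact ?K" by (intro compact_diff) auto
    show "continuous_on (?K - {0}) ?f"
      unfolding f
    proof -
      have "continuous_on (?K - {0}) w"
        by (rule cont[OF w]) (auto simp: \<Omega>_def)
      moreover have "continuous_on (?K - {0}) (kelvin y l w)"
        by (rule continuous_on_subset[OF cont_kelvin[OF w l]]) auto
      ultimately show "continuous_on (?K - {0}) (\<lambda>x. w x - kelvin y l w x - m / 2 * (1 - (l / norm (x - y)) ^ k))"
        using l by (intro continuous_intros) auto
    qed
    show "0 \<le> ?f z \<or> z \<in> interior ?K \<and> (\<exists>L\<le>0. has_laplacian ?f L z)" if z: "z \<in> ?K" "z \<noteq> 0" for z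
    proof -
      have zD: "z \<in> D" "z \<in> \<Omega>" using z by (auto simp: D_def \<Omega>_def)
      have lz: "l \<le> norm (z - y)" using z by (simp add: dist_norm norm_minus_commute)
      consider "norm (z - y) = l" | "norm z = 1" | "norm (z - y) > l" "norm z < 1"
        using z lz by fastforce
      then show ?thesis
      proof cases
        case 1
        then show ?thesis using l by (simp add: kelvin_def)
      next
        case 2
        have n: "norm (z - y) \<ge> 1 / 2" using norm_triangle_ineq2[of z y] 2 y by simp
        then have "l / norm (z - y) \<le> R / (1 / 2)" using l by (intro frac_le) auto
        then have "(l / norm (z - y)) ^ k \<le> (2 * R) ^ k" using l by (intro power_mono) auto
        then have "kelvin y l w z \<le> (2 * R) ^ k * S"
          unfolding kelvin_def k1 using positive[OF w subsetD[OF cball_\<Omega> reflect_mem[OF l lz]]] R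
          by (intro mult_mono S[OF w] reflect_mem[OF l lz]) auto
        moreover have "m \<le> w z" using m_le[OF w zD(1)] .
        moreover have "m / 2 * (1 - (l / norm (z - y)) ^ k) \<le> m / 2" using m l by simp
        ultimately have "0 \<le> ?f z" unfolding f using RS by linarith
        then show ?thesis ..
      next
        case 3
        have "open (ball 0 1 \<inter> (- cball y l))" by (intro open_Int) auto
        then have int: "z \<in> interior ?K"
          by (rule interiorI) (use 3 in \<open>auto simp: dist_norm norm_minus_commute\<close>)
        have ineq: "kelvin y l w z \<le> w z" "kelvin y l w2 z \<le> w2 z"
          using b w ww2(2) zD lz unfolding below_def by blast+
        have "has_laplacian w' (- reaction \<mu> (w z) (w2 z)) z"
          unfolding w'_def[abs_def] using has_laplacian_diff[OF eq[OF zD(2)] has_laplacian_const] by simp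
        from has_laplacian_diff[OF this lap_kelvin[OF l lz \<mu>0 eq ww2(1), of "m / 2"]]
        have "has_laplacian ?f (- reaction \<mu> (w z) (w2 z) - - reaction \<mu> (kelvin y l w z) (kelvin y l w2 z)) z"
          unfolding w'_def[abs_def] by blast
        moreover have "- reaction \<mu> (w z) (w2 z) - - reaction \<mu> (kelvin y l w z) (kelvin y l w2 z) \<le> 0"
          using reaction_mono[OF \<mu>0 _ ineq(1) _ ineq(2)] kelvin_pos[OF w l lz] kelvin_pos[OF ww2(2) l lz] by simp
        ultimately show ?thesis using int by blast
      qed
    qed
    show "- (m / 2) * norm z powr 0 \<le> ?f z" if z: "z \<in> ?K" "z \<noteq> 0" for z
    proof -
      have "z \<in> D" "l \<le> norm (z - y)" using z by (auto simp: D_def dist_norm norm_minus_commute)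
      then have "kelvin y l w z \<le> w z" using b w unfolding below_def by blast
      moreover have "m / 2 * (1 - (l / norm (z - y)) ^ k) \<le> m / 2" using m l by simp
      ultimately show ?thesis unfolding f using z by simp
    qed
  qed (use x dim k in \<open>auto simp: D_def dist_norm norm_minus_commute\<close>)
  then show ?thesis by (simp add: w'_def[abs_def])
qed

lemma has_derivative_path:
  assumes w: "w = u \<or> w = v" and p: "y + t\<^sup>2 *\<^sub>R (x - y) \<in> \<Omega>" and t: "t > 0"
  shows "((\<lambda>t. t ^ k * (w (y + t\<^sup>2 *\<^sub>R (x - y)) - c)) has_real_derivative
    2 * t ^ (k - 1) * ((t\<^sup>2 *\<^sub>R (x - y)) \<bullet> grad w (y + t\<^sup>2 *\<^sub>R (x - y))
      + k / 2 * (w (y + t\<^sup>2 *\<^sub>R (x - y)) - c))) (at t)"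
proof -
  have "((\<lambda>t. y + t\<^sup>2 *\<^sub>R (x - y)) has_derivative (\<lambda>h. (2 * t * h) *\<^sub>R (x - y))) (at t)"
    by (auto intro!: derivative_eq_intros simp: mult.commute)
  from has_derivative_compose[OF this der[OF w p]]
  have "((\<lambda>t. w (y + t\<^sup>2 *\<^sub>R (x - y))) has_real_derivative
      (2 * t * (grad w (y + t\<^sup>2 *\<^sub>R (x - y)) \<bullet> (x - y)))) (at t)"
    unfolding has_field_derivative_def by (auto simp: algebra_simps elim!: has_derivative_eq_rhs)
  then have "((\<lambda>t. t ^ k * (w (y + t\<^sup>2 *\<^sub>R (x - y)) - c)) has_real_derivative
     (k * t ^ (k - 1) * (w (y + t\<^sup>2 *\<^sub>R (x - y)) - c)
      + (2 * t * (grad w (y + t\<^sup>2 *\<^sub>R (x - y)) \<bullet> (x - y))) * t ^ k)) (at t)"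
    by (auto intro!: derivative_eq_intros)
  moreover have "t ^ k = t ^ (k - 1) * t" using k1 by (metis power_minus_mult)
  ultimately show ?thesis
    by (elim DERIV_cong) (simp add: inner_commute power2_eq_square algebra_simps)
qed

text \<open>Up to a positive factor, the derivative of \<open>t\<^sup>k w (y + t\<^sup>2 (x - y))\<close> at \<open>t = 1\<close>. As the Kelvin
  transform of \<open>w\<close> with radius \<open>t |x - y|\<close> takes exactly this value at \<open>x\<close>, the infinitesimal form of
  the comparison is the inequality \<open>0 \<le> dilation_rate w x\<close>.\<close>

definition dilation_rate :: "('a \<Rightarrow> real) \<Rightarrow> 'a \<Rightarrow> real" where
  "dilation_rate w x = (x - y) \<bullet> grad w x + k / 2 * w x"

lemma dilation_rate_ge:
  assumes w: "w = u \<or> w = v" and b: "\<And>l'. 0 < l' \<Longrightarrow> l' \<le> l \<Longrightarrow> below l'" and l: "l \<le> R"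
    and x: "norm (x - y) \<le> l"
  shows "k / 2 * (m / 2) \<le> dilation_rate w x"
proof (cases "x = y")
  case True
  have "m / 2 \<le> w x" using m_le[OF w subsetD[OF cball_D], of x] True R m by simp
  then have "k / 2 * (m / 2) \<le> k / 2 * w x" by (intro mult_left_mono) auto
  then show ?thesis using True by (simp add: dilation_rate_def)
next
  case False
  define r where "r = norm (x - y)"
  have r: "0 < r" "r \<le> R" using False x l by (auto simp: r_def)
  have xR: "x \<in> cball y R" using r by (simp add: r_def dist_norm norm_minus_commute)
  then have xD: "x \<in> D" "x \<in> \<Omega>" using cball_D cball_\<Omega> by blast+
  define \<psi> where "\<psi> t = t ^ k * (w (y + t\<^sup>2 *\<^sub>R (x - y)) - m / 2)" for t
  have le: "\<psi> t \<le> \<psi> 1" if t: "0 < t" "t < 1" for t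
  proof -
    have tr: "0 < t * r" "t * r \<le> r" using t r by (simp_all add: mult_left_le_one_le)
    then have "below (t * r)" using x by (intro b) (auto simp: r_def)
    moreover have "0 < t * r" "t * r \<le> R" "t * r \<le> norm (x - y)"
      using tr r unfolding r_def[symmetric] by linarith+
    ultimately have "kelvin y (t * r) (\<lambda>z. w z - m / 2) x \<le> w x - m / 2"
      using w xD by (intro below_improve)
    then show ?thesis using r by (simp add: \<psi>_def kelvin_def k1 r_def[symmetric])
  qed
  have d: "(\<psi> has_real_derivative 2 * ((x - y) \<bullet> grad w x + k / 2 * (w x - m / 2))) (at 1)"
    using has_derivative_path[OF w, of 1 x "m / 2"] xD unfolding \<psi>_def by simp
  have "0 \<le> 2 * ((x - y) \<bullet> grad w x + k / 2 * (w x - m / 2))"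
  proof (rule ccontr)
    assume "\<not> ?thesis"
    then obtain d where d: "d > 0" "\<And>h. 0 < h \<Longrightarrow> h < d \<Longrightarrow> \<psi> 1 < \<psi> (1 - h)"
      using DERIV_neg_dec_left[OF d] by auto
    define h where "h = min d 1 / 2"
    have "0 < h" "h < d" "h < 1" using d(1) by (auto simp: h_def)
    then show False using d(2)[of h] le[of "1 - h"] by simp
  qed
  then show ?thesis by (simp add: dilation_rate_def algebra_simps)
qed

lemma below_near:
  assumes w: "w = u \<or> w = v" and rate: "\<And>z. norm (z - y) \<le> r \<Longrightarrow> 0 \<le> dilation_rate w z" and r: "r \<le> R"
    and l: "0 < l" "l \<le> norm (x - y)" "norm (x - y) \<le> r"
  shows "kelvin y l w x \<le> w x"
proof -
  define t where "t = l / norm (x - y)"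
  have n: "norm (x - y) > 0" using l by linarith
  have t: "0 < t" "t \<le> 1" using l n by (auto simp: t_def)
  define \<psi> where "\<psi> s = s ^ k * (w (y + s\<^sup>2 *\<^sub>R (x - y)) - 0)" for s
  have "\<psi> t \<le> \<psi> 1"
  proof (rule DERIV_nonneg_imp_nondecreasing[OF t(2)])
    fix s assume s: "t \<le> s" "s \<le> 1"
    let ?p = "y + s\<^sup>2 *\<^sub>R (x - y)"
    have "s\<^sup>2 \<le> 1" using s t by (simp add: power_le_one)
    then have "s\<^sup>2 * norm (x - y) \<le> 1 * r" using l by (intro mult_mono) auto
    then have p: "norm (?p - y) \<le> r" by simp
    then have "?p \<in> \<Omega>" using r cball_\<Omega> by (auto simp: dist_norm)
    from has_derivative_path[OF w this, of 0] s t
    have "(\<psi> has_real_derivative 2 * s ^ (k - 1) * dilation_rate w ?p) (at s)"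
      unfolding \<psi>_def dilation_rate_def by simp
    moreover have "0 \<le> 2 * s ^ (k - 1) * dilation_rate w ?p" using rate[OF p] s t by simp
    ultimately show "\<exists>y. (\<psi> has_real_derivative y) (at s) \<and> 0 \<le> y" by blast
  qed
  then show ?thesis by (simp add: \<psi>_def kelvin_def k1 t_def)
qed

lemma cont_dilation_rate:
  assumes w: "w = u \<or> w = v"
  shows "continuous_on (cball y R) (dilation_rate w)"
proof -
  have "continuous_on (cball y R) (grad w)"
    using cont_grad[OF w] cball_\<Omega> by (intro continuous_at_imp_continuous_on) blast
  then show ?thesis unfolding dilation_rate_def by (intro continuous_intros cont[OF w cball_\<Omega>])
qed

text \<open>The comparison extends to slightly larger radii. Near the sphere it follows from \<open>dilation_rate > 0\<close>; away
  from the sphere the strict inequality survives a small change of the radius. The case \<open>l = 0\<close>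
  starts the process.\<close>

lemma below_extend:
  assumes b: "\<And>l'. 0 < l' \<Longrightarrow> l' \<le> l \<Longrightarrow> below l'" and l: "0 \<le> l" "l < R"
  shows "\<exists>d>0. \<forall>l'. l < l' \<and> l' \<le> l + d \<longrightarrow> below l'"
proof -
  have ex: "\<exists>d>0. \<forall>l' x. l < l' \<and> l' \<le> l + d \<and> x \<in> D \<and> l' \<le> norm (x - y) \<longrightarrow> kelvin y l' w x \<le> w x"
    if w: "w = u \<or> w = v" for w
  proof -
    have Z0: "k / 2 * (m / 2) \<le> dilation_rate w z" if "norm (z - y) \<le> l" for z
      using dilation_rate_ge[OF w b _ that] l by simp
    have "uniformly_continuous_on (cball y R) (dilation_rate w)"
      by (intro compact_uniformly_continuous cont_dilation_rate[OF w]) auto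
    moreover have km: "k / 2 * (m / 2) > 0" using m k1 by simp
    ultimately obtain e where e: "e > 0" "\<And>z z'. z \<in> cball y R \<Longrightarrow> z' \<in> cball y R \<Longrightarrow> dist z' z < e
        \<Longrightarrow> dist (dilation_rate w z') (dilation_rate w z) < k / 2 * (m / 2)"
      unfolding uniformly_continuous_on_def by meson
    define r where "r = l + min (e / 2) (R - l)"
    have r: "l < r" "r \<le> R" "r - l < e" using e(1) l by (auto simp: r_def)
    have Zr: "0 \<le> dilation_rate w z" if z: "norm (z - y) \<le> r" for z
    proof (cases "norm (z - y) \<le> l")
      case True
      then show ?thesis using Z0[OF True] km by linarith
    next
      case False
      \<comment> \<open>The radial projection of \<open>z\<close> to the sphere of radius \<open>l\<close>, where \<open>dilation_rate\<close> is bounded below.\<close>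
      define z' where "z' = y + (l / norm (z - y)) *\<^sub>R (z - y)"
      have n: "norm (z - y) > l" "norm (z - y) > 0" using False l by linarith+
      have z': "norm (z' - y) = l" using n l by (simp add: z'_def)
      have "z' - z = (l / norm (z - y) - 1) *\<^sub>R (z - y)" by (simp add: z'_def algebra_simps)
      then have "norm (z' - z) = \<bar>l / norm (z - y) - 1\<bar> * norm (z - y)" by simp
      also have "\<dots> = norm (z - y) - l" using n by (simp add: abs_if field_simps)
      finally have "dist z' z < e" using z r by (simp add: dist_norm)
      then have "dist (dilation_rate w z') (dilation_rate w z) < k / 2 * (m / 2)"
        using z z' r l by (intro e(2)) (auto simp: dist_norm norm_minus_commute)
      then show ?thesis using Z0[of z'] z' unfolding dist_real_def by linarith
    qed
    define \<Phi> where "\<Phi> = (\<lambda>(t, \<zeta>). (t * norm \<zeta>) ^ k * w (y + t\<^sup>2 *\<^sub>R \<zeta>))"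
    define Q where "Q = {l..r} \<times> cball (0::'a) (1 / r)"
    have ker: "kelvin y t w x = \<Phi> (t, (1 / (norm (x - y))\<^sup>2) *\<^sub>R (x - y))" for t x
      unfolding kelvin_eq \<Phi>_def k1 by simp
    have "continuous_on Q \<Phi>"
    proof -
      have "y + (fst p)\<^sup>2 *\<^sub>R snd p \<in> cball y R" if "p \<in> Q" for p
      proof -
        have p: "l \<le> fst p" "fst p \<le> r" "norm (snd p) \<le> 1 / r" using that by (auto simp: Q_def)
        have "(fst p)\<^sup>2 * norm (snd p) \<le> r\<^sup>2 * (1 / r)"
          using p l by (intro mult_mono power_mono) auto
        also have "\<dots> \<le> R" using r l by (simp add: power2_eq_square)
        finally show ?thesis by (simp add: dist_norm)
      qed
      then have "continuous_on Q (\<lambda>p. w (y + (fst p)\<^sup>2 *\<^sub>R snd p))"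
        by (intro continuous_on_compose2[OF cont[OF w cball_\<Omega>]] continuous_intros) auto
      then show ?thesis unfolding \<Phi>_def case_prod_beta by (intro continuous_intros)
    qed
    moreover have "compact Q" unfolding Q_def by (intro compact_Times) auto
    ultimately have uc: "uniformly_continuous_on Q \<Phi>" by (rule compact_uniformly_continuous)
    \<comment> \<open>A lower bound for the gap in the comparison at radius \<open>l\<close>, at distance at least \<open>r\<close> from \<open>y\<close>.\<close>
    define \<kappa> where "\<kappa> = m / 2 * (1 - (l / r) ^ k)"
    have "(l / r) ^ k < 1" using l r k1 by (intro power_less_one_iff[THEN iffD2]) auto
    then have \<kappa>: "\<kappa> > 0" using m by (simp add: \<kappa>_def)
    obtain d where d: "d > 0" "\<And>p p'. p \<in> Q \<Longrightarrow> p' \<in> Q \<Longrightarrow> dist p' p < d \<Longrightarrow> dist (\<Phi> p') (\<Phi> p) < \<kappa>"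
      using uc \<kappa> unfolding uniformly_continuous_on_def by meson
    define \<delta> where "\<delta> = min (d / 2) (r - l)"
    have \<delta>: "\<delta> > 0" "\<delta> < d" "l + \<delta> \<le> r" using d(1) r by (auto simp: \<delta>_def)
    have "kelvin y t w x \<le> w x" if t: "l < t" "t \<le> l + \<delta>" and x: "x \<in> D" "t \<le> norm (x - y)" for t x
    proof (cases "norm (x - y) \<le> r")
      case True
      then show ?thesis using below_near[OF w Zr r(2)] t x l by simp
    next
      case False
      define \<zeta> where "\<zeta> = (1 / (norm (x - y))\<^sup>2) *\<^sub>R (x - y)"
      have n: "norm (x - y) > r" "norm (x - y) > 0" using False r l by linarith+
      have "norm \<zeta> = 1 / norm (x - y)" using n by (simp add: \<zeta>_def power2_eq_square)
      then have "norm \<zeta> \<le> 1 / r" using n r l by (simp add: frac_le)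
      then have "(t, \<zeta>) \<in> Q" "(l, \<zeta>) \<in> Q" using t \<delta> r by (auto simp: Q_def)
      moreover have "dist (t, \<zeta>) (l, \<zeta>) < d" using t \<delta> by (simp add: dist_Pair_Pair dist_real_def)
      ultimately have "dist (\<Phi> (t, \<zeta>)) (\<Phi> (l, \<zeta>)) < \<kappa>" by (intro d(2))
      then have 1: "kelvin y t w x \<le> kelvin y l w x + \<kappa>"
        unfolding ker \<zeta>_def[symmetric] by (simp add: dist_real_def)
      have "kelvin y l w x + \<kappa> \<le> w x"
      proof (cases "l = 0")
        case True
        then show ?thesis using m_le[OF w x(1)] m k1 by (simp add: kelvin_def \<kappa>_def k1 zero_power)
      next
        case False
        then have "kelvin y l w x - m / 2 * (l / norm (x - y)) ^ k \<le> w x - m / 2"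
          using below_improve[OF _ _ b w x(1), of l] l n r by (simp add: kelvin_shift)
        moreover have "(l / norm (x - y)) ^ k \<le> (l / r) ^ k"
          using l n r by (intro power_mono frac_le) auto
        then have "m / 2 * (l / norm (x - y)) ^ k \<le> m / 2 * (l / r) ^ k" using m by simp
        ultimately show ?thesis by (simp add: \<kappa>_def algebra_simps)
      qed
      with 1 show ?thesis by linarith
    qed
    then show ?thesis using \<delta>(1) by blast
  qed
  obtain d1 d2 where "d1 > 0" "\<forall>l' x. l < l' \<and> l' \<le> l + d1 \<and> x \<in> D \<and> l' \<le> norm (x - y) \<longrightarrow> kelvin y l' u x \<le> u x"
    "d2 > 0" "\<forall>l' x. l < l' \<and> l' \<le> l + d2 \<and> x \<in> D \<and> l' \<le> norm (x - y) \<longrightarrow> kelvin y l' v x \<le> v x"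
    using ex[of u] ex[of v] by blast
  then show ?thesis
    by (intro exI[of _ "min d1 d2"]) (auto simp: below_def min_le_iff_disj)
qed

text \<open>The radii up to which the comparison holds form a closed interval, which the extension lemma
  shows to be all of \<open>[0, R]\<close>.\<close>

lemma below_all: "0 < l \<Longrightarrow> l \<le> R \<Longrightarrow> below l"
proof -
  define T where "T = {t \<in> {0..R}. \<forall>l'. 0 < l' \<and> l' \<le> t \<longrightarrow> below l'}"
  define s where "s = Sup T"
  have "\<forall>l'. 0 < l' \<and> l' \<le> 0 \<longrightarrow> below l'" by (meson not_le)
  moreover have "0 \<in> {0..R}" using R(1) by simp
  ultimately have T0: "0 \<in> T" unfolding T_def by blast
  have TR: "t \<le> R" if "t \<in> T" for t using that unfolding T_def by simp
  then have bdd: "bdd_above T" by (rule bdd_aboveI)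
  have s: "0 \<le> s" "s \<le> R"
    unfolding s_def using cSup_upper[OF T0 bdd] cSup_least[of T R] T0 TR by blast+
  have lt: "below l'" if l': "0 < l'" "l' < s" for l'
  proof -
    obtain t where t: "t \<in> T" "l' < t"
      using less_cSupD[of T l'] l' T0 unfolding s_def by blast
    then have "\<forall>l'. 0 < l' \<and> l' \<le> t \<longrightarrow> below l'" unfolding T_def by blast
    then show ?thesis using l'(1) less_imp_le[OF t(2)] by blast
  qed
  have at_s: "below s" if s0: "0 < s"
    unfolding below_def
  proof (intro allI impI)
    fix w x assume w: "w = u \<or> w = v" and x: "x \<in> D" "s \<le> norm (x - y)"
    have n: "norm (x - y) > 0" using s0 x by linarith
    have "y + (s / norm (x - y))\<^sup>2 *\<^sub>R (x - y) \<in> \<Omega>"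
      using reflect_mem[OF s0 s(2) x(2)] cball_\<Omega> by blast
    then have "isCont w (y + (s / norm (x - y))\<^sup>2 *\<^sub>R (x - y))"
      using der[OF w] has_derivative_continuous by blast
    then have "isCont (\<lambda>t. w (y + (t / norm (x - y))\<^sup>2 *\<^sub>R (x - y))) s"
      using n by (intro isCont_o2[where g = w and f = "\<lambda>t. y + (t / norm (x - y))\<^sup>2 *\<^sub>R (x - y)"] continuous_intros) auto
    then have "isCont (\<lambda>t. kelvin y t w x) s"
      unfolding kelvin_def using n by (intro continuous_intros) auto
    then have lim: "((\<lambda>t. kelvin y t w x) \<longlongrightarrow> kelvin y s w x) (at_left s)"
      unfolding isCont_def by (rule filterlim_mono) (auto simp: at_le)
    have "\<forall>\<^sub>F t in at_left s. kelvin y t w x \<le> w x"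
      using eventually_at_left_real[OF s0]
    proof eventually_elim
      case (elim t)
      then have "below t" "t \<le> norm (x - y)" using lt[of t] x by auto
      then show ?case using w x(1) unfolding below_def by blast
    qed
    then show "kelvin y s w x \<le> w x"
      using tendsto_upperbound[OF lim] by simp
  qed
  have all_s: "below l'" if "0 < l'" "l' \<le> s" for l'
  proof (cases "l' = s")
    case True
    then show ?thesis using at_s that(1) by simp
  next
    case False
    then have "l' < s" using that(2) by simp
    then show ?thesis by (rule lt[OF that(1)])
  qed
  have "s = R"
  proof (rule ccontr)
    assume "s \<noteq> R"
    then have sR: "s < R" using s by simp
    obtain d where d: "d > 0" "\<And>l'. s < l' \<Longrightarrow> l' \<le> s + d \<Longrightarrow> below l'"
      using below_extend[OF all_s s(1) sR] by blast
    define t where "t = min (s + d) R"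
    have "below l'" if "0 < l'" "l' \<le> t" for l'
      using all_s[of l'] d(2)[of l'] that by (cases "l' \<le> s") (auto simp: t_def)
    moreover have "t \<in> {0..R}" using s d(1) sR by (simp add: t_def)
    ultimately have "t \<in> T" unfolding T_def by blast
    then have "t \<le> s" unfolding s_def by (intro cSup_upper bdd)
    then show False using d(1) sR by (auto simp: t_def)
  qed
  then show "0 < l \<Longrightarrow> l \<le> R \<Longrightarrow> below l" using all_s by blast
qed

theorem dilation_rate_nonneg:
  assumes "w = u \<or> w = v" "x \<in> cball y R"
  shows "0 \<le> (x - y) \<bullet> grad w x + k / 2 * w x"
proof -
  have "k / 2 * (m / 2) \<le> dilation_rate w x"
    using assms below_all by (intro dilation_rate_ge[of w R]) (auto simp: dist_norm norm_minus_commute)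
  moreover have "0 \<le> k / 2 * (m / 2)" using m by simp
  ultimately show ?thesis unfolding dilation_rate_def by linarith
qed

end

section \<open>Consequences of the moving spheres for one component\<close>

text \<open>Comparison with the explicit solution of \<open>- \<Delta> f = q\<close> on a ball.\<close>

lemma superharmonic_paraboloid:
  fixes w :: "'a::euclidean_space \<Rightarrow> real"
  assumes cont: "continuous_on (cball b r) w" and q: "q \<ge> 0"
    and lap: "\<And>x. x \<in> ball b r \<Longrightarrow> \<exists>L\<le>-q. has_laplacian w L x"
    and ge: "\<And>x. x \<in> cball b r \<Longrightarrow> c \<le> w x" and x: "x \<in> cball b r"
  shows "c + q / (2 * DIM('a)) * (r\<^sup>2 - (norm (x - b))\<^sup>2) \<le> w x"
proof -
  define e where "e = q / (2 * DIM('a))"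
  have e: "e * real (2 * DIM('a)) = q" by (simp add: e_def)
  let ?f = "\<lambda>x. w x - (c + e * (r\<^sup>2 - (norm (x - b))\<^sup>2))"
  have "0 \<le> ?f x"
  proof (rule min_principle[of "cball b r" ?f])
    show "continuous_on (cball b r) ?f" by (intro continuous_intros cont)
    show "0 \<le> ?f z \<or> z \<in> interior (cball b r) \<and> (\<exists>L\<le>0. has_laplacian ?f L z)"
      if z: "z \<in> cball b r" for z
    proof (cases "dist b z = r")
      case True
      then show ?thesis using ge[OF z] by (simp add: dist_norm norm_minus_commute)
    next
      case False
      then have zb: "z \<in> ball b r" using z by simp
      then obtain L where L: "L \<le> - q" "has_laplacian w L z" using lap by blast
      have "has_laplacian ?f (L - (0 + e * (0 - real (2 * DIM('a))))) z"
        by (intro has_laplacian_diff has_laplacian_add has_laplacian_cmult has_laplacian_const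
            has_laplacian_sq L)
      moreover have "L - (0 + e * (0 - real (2 * DIM('a)))) \<le> 0" using e L(1) by (simp add: algebra_simps)
      ultimately show ?thesis using zb by (auto simp: interior_cball)
    qed
  qed (use x in auto)
  then show ?thesis by (simp add: e_def)
qed

text \<open>A pair whose first component is bounded near the origin; \<open>v\<close> will be shown to be bounded too.\<close>

locale bounded_first = positive_pair u v k \<mu>1 \<mu>2 \<beta> a
  for u v :: "'a::euclidean_space \<Rightarrow> real" and k :: nat and \<mu>1 \<mu>2 \<beta> a :: real +
  fixes m M :: real
  assumes m: "m > 0" and m_le: "\<And>w x. w = u \<or> w = v \<Longrightarrow> x \<in> D \<Longrightarrow> m \<le> w x"
    and M: "\<And>x. x \<in> D \<Longrightarrow> u x \<le> M"
begin

lemma M_ge: "m \<le> M"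
proof -
  obtain b :: 'a where "b \<in> Basis" using nonempty_Basis by blast
  then have "b \<in> D" by (auto simp: D_def)
  then show ?thesis using m_le[of u b] M[of b] by simp
qed

text \<open>Moving spheres from a centre at distance \<open>l\<close> in the direction of \<open>grad v x\<close> bound the logarithmic
  gradient of \<open>v\<close> by a multiple of \<open>1 / l\<close>.\<close>

lemma gradient_bound:
  assumes l: "0 < l" "2 * l < norm x" "norm x + l \<le> 1 / 2"
    and S: "\<And>z. z \<in> cball x (2 * l) \<Longrightarrow> v z \<le> S" "M \<le> S" and lS: "(2 * l) ^ k * S \<le> m / 2"
  shows "l * norm (grad v x) \<le> k / 2 * v x"
proof (cases "grad v x = 0")
  case True
  have "x \<in> \<Omega>" using l by (auto simp: \<Omega>_def)
  then show ?thesis using positive[of v x] True by simp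
next
  case False
  define y where "y = x + (l / norm (grad v x)) *\<^sub>R grad v x"
  have yx: "norm (y - x) = l" using False l by (simp add: y_def)
  have y: "l < norm y" "norm y \<le> 1 / 2"
    using norm_triangle_ineq2[of x "x - y"] norm_triangle_ineq[of x "y - x"] yx l
    by (auto simp: norm_minus_commute)
  have cb: "z \<in> D" "z \<in> cball x (2 * l)" if "z \<in> cball y l" for z
  proof -
    have zy: "norm (z - y) \<le> l" using that by (simp add: dist_norm norm_minus_commute)
    have "norm (z - x) \<le> norm (z - y) + norm (y - x)" using norm_triangle_ineq[of "z - y" "y - x"] by simp
    then show "z \<in> cball x (2 * l)" using zy yx by (simp add: dist_norm norm_minus_commute)
    have "norm z \<le> norm y + norm (z - y)" using norm_triangle_ineq[of y "z - y"] by simp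
    moreover have "z \<noteq> 0" using zy y by auto
    ultimately show "z \<in> D" using zy y by (simp add: D_def)
  qed
  interpret sphere_setup u v k \<mu>1 \<mu>2 \<beta> a m S l y
  proof (unfold_locales)
    fix w z assume "w = u \<or> w = v" "z \<in> cball y l"
    then show "w z \<le> S" using cb[of z] S(1)[of z] M[of z] S(2) by fastforce
  qed (use m m_le l y lS in auto)
  have "0 \<le> (x - y) \<bullet> grad v x + k / 2 * v x"
    using yx by (intro dilation_rate_nonneg) (auto simp: dist_norm)
  moreover have "(x - y) \<bullet> grad v x = - (l * norm (grad v x))"
    using False by (simp add: y_def power2_norm_eq_inner[symmetric] power2_eq_square)
  ultimately show ?thesis by linarith
qed

text \<open>A bound for the logarithmic gradient prevents \<open>v\<close> from falling below half of its central value.\<close>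

lemma half_bound:
  assumes sub: "cball b r \<subseteq> \<Omega>" and g: "\<And>x. x \<in> cball b r \<Longrightarrow> norm (grad v x) \<le> L * v x"
    and Lr: "L * r \<le> 1 / 2" and x: "x \<in> cball b r"
  shows "v b / 2 \<le> v x"
proof -
  have r: "0 \<le> r" using x order_trans[OF zero_le_dist] unfolding mem_cball by blast
  define p where "p t = b + t *\<^sub>R (x - b)" for t
  have p: "p t \<in> cball b r" if "0 \<le> t" "t \<le> 1" for t
  proof -
    have "norm (t *\<^sub>R (x - b)) \<le> 1 * r"
      using that x r unfolding norm_scaleR by (intro mult_mono) (auto simp: dist_norm norm_minus_commute)
    then show ?thesis by (simp add: p_def dist_norm)
  qed
  have d: "((\<lambda>t. ln (v (p t))) has_real_derivative (grad v (p t) \<bullet> (x - b)) / v (p t)) (at t)"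
    if t: "0 \<le> t" "t \<le> 1" for t
  proof -
    have pt: "p t \<in> \<Omega>" using p[OF t] sub by blast
    have "(p has_derivative (\<lambda>h. h *\<^sub>R (x - b))) (at t)"
      unfolding p_def by (auto intro!: derivative_eq_intros)
    from has_derivative_compose[OF this der[OF _ pt, of v]]
    have "((\<lambda>t. v (p t)) has_real_derivative (grad v (p t) \<bullet> (x - b))) (at t)"
      unfolding has_field_derivative_def by (auto simp: mult.commute elim!: has_derivative_eq_rhs)
    from DERIV_chain2[OF DERIV_ln_divide[of "v (p t)"] this] show ?thesis
      using positive[of v, OF _ pt] by simp
  qed
  obtain t where t: "0 < t" "t < 1" "ln (v (p 1)) - ln (v (p 0)) = (1 - 0) * ((grad v (p t) \<bullet> (x - b)) / v (p t))"
    using MVT2[of 0 1 "\<lambda>t. ln (v (p t))", OF zero_less_one d] by blast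
  have pt: "p t \<in> cball b r" using p t by simp
  have vp: "v (p t) > 0" using positive[of v "p t"] pt sub by blast
  have "\<bar>grad v (p t) \<bullet> (x - b)\<bar> \<le> norm (grad v (p t)) * norm (x - b)" by (rule Cauchy_Schwarz_ineq2)
  also have "\<dots> \<le> (L * v (p t)) * r"
    using g[OF pt] x by (intro mult_mono) (auto simp: dist_norm norm_minus_commute intro: order_trans[OF norm_ge_zero])
  also have "\<dots> = (L * r) * v (p t)" by simp
  also have "\<dots> \<le> 1 / 2 * v (p t)" using Lr vp by (intro mult_right_mono) auto
  finally have "- (1 / 2) \<le> (grad v (p t) \<bullet> (x - b)) / v (p t)" using vp by (simp add: field_simps)
  then have "ln (v b) + - (1 / 2) \<le> ln (v x)" using t by (simp add: p_def)
  moreover have vb: "v b > 0" "v x > 0" using positive[of v] sub x r by (auto simp: subset_iff)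
  ultimately have "exp (ln (v b) + - (1 / 2)) \<le> v x" by (metis exp_le_cancel_iff exp_ln)
  moreover have "exp (ln (v b) + - (1 / 2)) = v b * exp (- (1 / 2))" using vb by (simp only: exp_add exp_ln)
  moreover have "v b * (1 + - (1 / 2)) \<le> v b * exp (- (1 / 2))"
    using vb by (intro mult_left_mono exp_ge_add_one_self) auto
  ultimately show ?thesis by simp
qed

lemma norm_near: "norm (z - b) \<le> r \<Longrightarrow> norm b - r \<le> norm z \<and> norm z \<le> norm b + r"
  for z b :: 'a
  using norm_triangle_ineq2[of b "b - z"] norm_triangle_ineq2[of z b] by (auto simp: norm_minus_commute)

text \<open>If moving spheres of radius \<open>l\<close> are available near \<open>b\<close>, then \<open>v\<close> is comparable to \<open>v b\<close> on a ball of
  radius proportional to \<open>l\<close>; there \<open>- \<Delta> v\<close> is at least a multiple of \<open>v b\<close> to the power \<open>1 + 2 a\<close>, and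
  comparison with a paraboloid is compatible with this only if \<open>(v b)\<^sup>a l\<close> is bounded. A concentrated bubble would
  violate this.\<close>

lemma blowup_scale:
  obtains C where "C > 0"
    "\<And>b l S. 0 < l \<Longrightarrow> 5 * l < norm b \<Longrightarrow> norm b + 2 * l \<le> 1 / 2
      \<Longrightarrow> (\<And>z. z \<in> cball b (3 * l) \<Longrightarrow> v z \<le> S) \<Longrightarrow> M \<le> S \<Longrightarrow> (2 * l) ^ k * S \<le> m / 2
      \<Longrightarrow> v b powr a * l \<le> C"
proof -
  define C where "C = sqrt (2 * DIM('a) * real k ^ 2 * 2 powr (1 + 2 * a) / \<mu>2)"
  have Cpos: "C > 0" using coeff k by (simp add: C_def)
  have main: "v b powr a * l \<le> C"
    if l: "0 < l" "5 * l < norm b" "norm b + 2 * l \<le> 1 / 2"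
    and S: "\<And>z. z \<in> cball b (3 * l) \<Longrightarrow> v z \<le> S" "M \<le> S" and lS: "(2 * l) ^ k * S \<le> m / 2"
    for b :: 'a and l S
  proof -
    define V where "V = v b"
    have k2: "real k \<ge> 2" using k by simp
    have lk: "l / k \<le> l" using l(1) k2 by (simp add: field_simps)
    have mem: "norm (x - b) \<le> l \<and> 4 * l < norm x \<and> norm x \<le> norm b + l" if "x \<in> cball b l" for x
      using that norm_near[of x b l] l by (auto simp: dist_norm norm_minus_commute)
    have sub: "cball b l \<subseteq> \<Omega>"
    proof
      fix x assume "x \<in> cball b l"
      from mem[OF this] l show "x \<in> \<Omega>" by (auto simp: \<Omega>_def)
    qed
    have lk_sub: "cball b (l / k) \<subseteq> cball b l" using lk by (rule subset_cball)
    have grad: "norm (grad v x) \<le> (k / (2 * l)) * v x" if x: "x \<in> cball b l" for x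
    proof -
      have "z \<in> cball b (3 * l)" if "z \<in> cball x (2 * l)" for z
        using that x dist_triangle[of b z x] by simp
      then have "l * norm (grad v x) \<le> k / 2 * v x"
        using mem[OF x] l S lS by (intro gradient_bound[where S = S]) auto
      then show ?thesis using l by (simp add: field_simps)
    qed
    have V: "V > 0" using positive[of v b] subsetD[OF sub, of b] l by (simp add: V_def)
    have half: "V / 2 \<le> v x" if x: "x \<in> cball b (l / k)" for x
      unfolding V_def
    proof (rule half_bound[OF _ _ _ x])
      show "cball b (l / k) \<subseteq> \<Omega>" using sub lk_sub by blast
      show "norm (grad v x) \<le> (k / (2 * l)) * v x" if "x \<in> cball b (l / k)" for x
        using grad that lk_sub by blast
    qed (use l k2 in simp)
    define q where "q = \<mu>2 * (V / 2) powr (1 + 2 * a)"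
    have q: "q \<ge> 0" using coeff by (simp add: q_def)
    have "0 + q / (2 * DIM('a)) * ((l / k)\<^sup>2 - (norm (b - b))\<^sup>2) \<le> v b"
    proof (rule superharmonic_paraboloid[OF _ q])
      show "continuous_on (cball b (l / k)) v"
        by (rule cont) (use sub lk_sub in auto)
      show "\<exists>L\<le>- q. has_laplacian v L x" if x: "x \<in> ball b (l / k)" for x
      proof -
        have xx: "x \<in> cball b (l / k)" using x by simp
        then have x\<Omega>: "x \<in> \<Omega>" using sub lk_sub by blast
        have "(V / 2) powr (1 + 2 * a) \<le> v x powr (1 + 2 * a)"
          using half[OF xx] V a_bounds by (intro powr_mono2) auto
        then have "q \<le> reaction \<mu>2 (v x) (u x)"
          unfolding q_def reaction_def using coeff by (intro add_increasing2 mult_left_mono) auto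
        then show ?thesis using lap(2)[OF x\<Omega>] by (intro exI[of _ "- reaction \<mu>2 (v x) (u x)"]) auto
      qed
      show "0 \<le> v x" if "x \<in> cball b (l / k)" for x using half[OF that] V by linarith
    qed (use l k2 in auto)
    then have "q * l\<^sup>2 / (2 * DIM('a) * real k ^ 2) \<le> V"
      by (simp add: V_def power_divide)
    moreover have "2 * DIM('a) * real k ^ 2 > 0" using k2 by simp
    ultimately have 1: "q * l\<^sup>2 \<le> 2 * DIM('a) * real k ^ 2 * V"
      by (simp only: pos_divide_le_eq mult.commute)
    have VV: "V powr (1 + 2 * a) = V * (V powr a)\<^sup>2"
      using V powr_add[of V 1 "a + a"] powr_add[of V a a] by (simp add: power2_eq_square)
    have "q = \<mu>2 * V * (V powr a)\<^sup>2 / 2 powr (1 + 2 * a)"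
      using V by (simp add: q_def powr_divide VV)
    with 1 V have "\<mu>2 * (V powr a)\<^sup>2 * l\<^sup>2 / 2 powr (1 + 2 * a) \<le> 2 * DIM('a) * real k ^ 2"
      by (simp add: field_simps)
    then have "(V powr a * l)\<^sup>2 \<le> 2 * DIM('a) * real k ^ 2 * 2 powr (1 + 2 * a) / \<mu>2"
      using coeff by (simp add: power_mult_distrib field_simps)
    then show "v b powr a * l \<le> C" unfolding C_def V_def[symmetric] by (rule real_le_rsqrt)
  qed
  show ?thesis by (rule that[OF Cpos main])
qed

text \<open>The scale-invariant bound \<open>v x \<le> C |x| powr - (k / 2)\<close>.\<close>

lemma upper_bound:
  obtains C where "C > 0" "\<And>x. x \<noteq> 0 \<Longrightarrow> norm x \<le> 1 / 4 \<Longrightarrow> v x * norm x powr (k / 2) \<le> C"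
proof -
  obtain C0 where C0: "C0 > 0" and scale: "\<And>b l S. 0 < l \<Longrightarrow> 5 * l < norm b \<Longrightarrow> norm b + 2 * l \<le> 1 / 2
      \<Longrightarrow> (\<And>z. z \<in> cball b (3 * l) \<Longrightarrow> v z \<le> S) \<Longrightarrow> M \<le> S \<Longrightarrow> (2 * l) ^ k * S \<le> m / 2
      \<Longrightarrow> v b powr a * l \<le> C0"
    using blowup_scale by blast
  define p where "p = real k / 2"
  have p: "p > 0" "a * p = 1" using k by (simp_all add: p_def a)
  define A where "A = 2 powr p + M / m"
  define c where "c = (m / (2 * A)) powr (1 / k) / 2"
  have A: "A > 0" using m M_ge by (auto simp: A_def intro!: add_pos_nonneg)
  have c: "c > 0" "(2 * c) ^ k = m / (2 * A)"
    using m A k by (simp_all add: c_def powr_power)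
  define C1 where "C1 = max ((10 * C0) powr p) ((C0 / c) powr (2 / a))"
  have C1: "C1 > 0" using C0 by (simp add: C1_def less_max_iff_disj)
  have main: "v x * (norm x / 2) powr p \<le> C1" if x: "x \<noteq> 0" "norm x \<le> 1 / 4" for x
  proof -
    define \<rho> where "\<rho> = norm x / 2"
    have \<rho>: "0 < \<rho>" "\<rho> \<le> 1 / 8" using x by (auto simp: \<rho>_def)
    have sub: "cball x \<rho> \<subseteq> D"
    proof
      fix z assume "z \<in> cball x \<rho>"
      then have "norm x - \<rho> \<le> norm z \<and> norm z \<le> norm x + \<rho>"
        by (intro norm_near) (simp add: dist_norm norm_minus_commute)
      moreover have "norm x - \<rho> > 0" "norm x + \<rho> \<le> 1" using \<rho> x by (auto simp: \<rho>_def)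
      ultimately show "z \<in> D" by (auto simp: D_def)
    qed
    \<comment> \<open>Maximising this weighted function selects a point \<open>b\<close> near which \<open>v\<close> is controlled by \<open>v b\<close>.\<close>
    define \<phi> where "\<phi> z = v z * (\<rho> - dist x z) powr p" for z
    have "continuous_on (cball x \<rho>) \<phi>"
      unfolding \<phi>_def using sub D_subset p
      by (intro continuous_intros continuous_on_powr' cont) auto
    then obtain b where b: "b \<in> cball x \<rho>" "\<And>z. z \<in> cball x \<rho> \<Longrightarrow> \<phi> z \<le> \<phi> b"
      using continuous_attains_sup[of "cball x \<rho>" \<phi>] \<rho> by auto
    define d where "d = \<rho> - dist x b"
    define V where "V = v b"
    have bD: "b \<in> D" using b sub by blast
    have Vm: "m \<le> V" using m_le[of v b] bD by (simp add: V_def)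
    have V: "V > 0" using Vm m by simp
    have "v x > 0" using m_le[of v x] m sub \<rho> by force
    then have "0 < \<phi> x" using \<rho> by (simp add: \<phi>_def)
    also have le: "\<phi> x \<le> \<phi> b" using b \<rho> by simp
    finally have "d \<noteq> 0" by (auto simp: \<phi>_def d_def)
    then have d: "0 < d" "d \<le> \<rho>" using b by (auto simp: d_def)
    have near: "v z \<le> 2 powr p * V" if z: "dist b z \<le> d / 2" for z
    proof -
      have zx: "d / 2 \<le> \<rho> - dist x z" using dist_triangle[of x z b] z by (simp add: d_def)
      then have zc: "z \<in> cball x \<rho>" using d by simp
      have "v z * (d / 2) powr p \<le> \<phi> z"
        unfolding \<phi>_def using zx d p m_le[of v z] m zc sub
        by (intro mult_left_mono powr_mono2) (auto simp: subset_iff intro: order_trans[OF less_imp_le])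
      also have "\<dots> \<le> V * d powr p" using b(2)[OF zc] by (simp add: \<phi>_def V_def d_def)
      also have "d powr p = (d / 2) powr p * 2 powr p" using d by (simp add: powr_mult[symmetric])
      finally have "v z * (d / 2) powr p \<le> (2 powr p * V) * (d / 2) powr p" by (simp add: mult_ac)
      then show ?thesis using d by simp
    qed
    \<comment> \<open>A radius comparable to the largest one for which the moving-sphere constraints hold near \<open>b\<close>.\<close>
    define l where "l = min (d / 10) (c * V powr (- 1 / k))"
    have l: "0 < l" "l \<le> d / 10" "l \<le> c * V powr (- 1 / k)" using d c V by (auto simp: l_def)
    have nb: "norm x - (\<rho> - d) \<le> norm b \<and> norm b \<le> norm x + (\<rho> - d)"
      by (intro norm_near) (simp add: d_def dist_norm norm_minus_commute)
    have "V powr a * l \<le> C0"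
      unfolding V_def
    proof (rule scale[OF l(1)])
      show "5 * l < norm b" "norm b + 2 * l \<le> 1 / 2" using nb l d \<rho> x by (auto simp: \<rho>_def)
      show "v z \<le> A * V" if "z \<in> cball b (3 * l)" for z
      proof -
        have "v z \<le> 2 powr p * V" using that l d by (intro near) auto
        also have "\<dots> \<le> A * V" using V m M_ge by (intro mult_right_mono) (auto simp: A_def)
        finally show ?thesis .
      qed
      have "M = M / m * m" using m by simp
      also have "\<dots> \<le> M / m * V" using Vm m M_ge by (intro mult_left_mono) auto
      also have "\<dots> \<le> A * V" using V by (intro mult_right_mono) (auto simp: A_def)
      finally show "M \<le> A * V" .
      have "(2 * l) ^ k \<le> (2 * c * V powr (- 1 / k)) ^ k" using l by (intro power_mono) auto
      also have "\<dots> = (2 * c) ^ k * (V powr (- 1 / k)) ^ k" by (rule power_mult_distrib)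
      also have "(V powr (- 1 / k)) ^ k = V powr (k * (- 1 / k))" by (rule powr_power) (use V in simp)
      also have "\<dots> = 1 / V" using V k by (simp add: powr_minus_divide)
      finally have "(2 * l) ^ k * (A * V) \<le> (m / (2 * A) * (1 / V)) * (A * V)"
        unfolding c(2) using A V by (intro mult_right_mono) auto
      then show "(2 * l) ^ k * (A * V) \<le> m / 2" using A V by simp
    qed
    have "V * d powr p \<le> C1"
    proof (cases "l = d / 10")
      case True
      then have "V powr a * d = 10 * (V powr a * l)" by simp
      then have "V powr a * d \<le> 10 * C0" using \<open>V powr a * l \<le> C0\<close> by linarith
      then have "(V powr a * d) powr p \<le> (10 * C0) powr p" using p V d by (intro powr_mono2) auto
      moreover have "(V powr a * d) powr p = V * d powr p" using V d p by (simp add: powr_mult powr_powr)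
      ultimately show ?thesis by (simp add: C1_def)
    next
      case False
      then have "l = c * V powr (- 1 / k)" by (auto simp: l_def min_def split: if_splits)
      moreover have "V powr a * V powr (- 1 / k) = V powr (a / 2)" by (simp add: powr_add[symmetric] a field_simps)
      ultimately have "V powr (a / 2) \<le> C0 / c" using \<open>V powr a * l \<le> C0\<close> c by (simp add: field_simps)
      then have "(V powr (a / 2)) powr (2 / a) \<le> (C0 / c) powr (2 / a)" using a_bounds by (intro powr_mono2) auto
      then have "V \<le> (C0 / c) powr (2 / a)" using V a_bounds by (simp add: powr_powr)
      moreover have "d powr p \<le> 1" using d \<rho> p by (intro powr_le1) auto
      ultimately have "V * d powr p \<le> (C0 / c) powr (2 / a) * 1" using V by (intro mult_mono) auto
      then show ?thesis by (simp add: C1_def)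
    qed
    then show ?thesis using le by (simp add: \<phi>_def d_def V_def \<rho>_def)
  qed
  show ?thesis
  proof (rule that[of "C1 * 2 powr p"])
    fix x :: 'a assume "x \<noteq> 0" "norm x \<le> 1 / 4"
    from main[OF this] show "v x * norm x powr (k / 2) \<le> C1 * 2 powr p"
      unfolding p_def[symmetric] by (simp add: powr_divide field_simps)
  qed (use C1 in simp)
qed

text \<open>By the scale-invariant bound, moving spheres of radius \<open>|x| / 8\<close> are available at every point \<open>x\<close>
  close to the origin: the radius to the power \<open>k\<close> beats \<open>|x| powr - (k / 2)\<close>.\<close>

lemma harnack:
  obtains r where "0 < r" "r \<le> 1 / 8"
    "\<And>x z. x \<noteq> 0 \<Longrightarrow> norm x \<le> r \<Longrightarrow> z \<in> cball x (norm x / (16 * k)) \<Longrightarrow> v x / 2 \<le> v z"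
proof -
  obtain C where C: "C > 0" "\<And>x. x \<noteq> 0 \<Longrightarrow> norm x \<le> 1 / 4 \<Longrightarrow> v x * norm x powr (k / 2) \<le> C"
    using upper_bound by blast
  define p where "p = real k / 2"
  have p: "p > 0" "p \<le> k" using k by (simp_all add: p_def)
  define B where "B = C * 2 powr p + M"
  have B: "B > 0" using C m M_ge by (auto simp: B_def intro!: add_pos_nonneg)
  define r where "r = min (1 / 8) ((m / (2 * B)) powr (1 / p))"
  have r: "0 < r" "r \<le> 1 / 8" using B m by (auto simp: r_def)
  have rp: "r powr p \<le> m / (2 * B)"
  proof -
    have "r powr p \<le> ((m / (2 * B)) powr (1 / p)) powr p" using r p by (intro powr_mono2) (auto simp: r_def)
    also have "\<dots> = m / (2 * B)" using p m B by (simp add: powr_powr)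
    finally show ?thesis .
  qed
  have grad: "norm (grad v x) \<le> 4 * k / norm x * v x" if x: "x \<noteq> 0" "norm x \<le> r" for x
  proof -
    define s where "s = norm x"
    have s: "0 < s" "s \<le> 1 / 8" "s \<le> r" using x r by (auto simp: s_def)
    have sp: "s powr p \<le> m / (2 * B)" using powr_mono2[of p s r] s p rp by simp
    define S where "S = C * (s / 2) powr (- p) + M"
    have "s / 8 * norm (grad v x) \<le> k / 2 * v x"
    proof (rule gradient_bound)
      show "v z \<le> S" if "z \<in> cball x (2 * (s / 8))" for z
      proof -
        have z: "s - s / 4 \<le> norm z \<and> norm z \<le> s + s / 4"
          unfolding s_def by (rule norm_near) (use that in \<open>simp add: dist_norm norm_minus_commute s_def\<close>)
        then have z0: "z \<noteq> 0" "norm z \<le> 1 / 4" using s by auto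
        have "(s / 2) powr p \<le> norm z powr p" using z s p by (intro powr_mono2) auto
        then have "v z * (s / 2) powr p \<le> v z * norm z powr p"
          using positive[of v z] z0 by (intro mult_left_mono) (auto simp: \<Omega>_def)
        also have "\<dots> \<le> C" using C(2)[OF z0] by (simp add: p_def)
        finally have "v z \<le> C * (s / 2) powr (- p)"
          using s by (simp add: powr_minus field_simps)
        then show ?thesis using m M_ge by (simp add: S_def)
      qed
      have "(2 * (s / 8)) ^ k \<le> s ^ k" using s by (intro power_mono) auto
      also have "s ^ k = s powr k" using s by (simp add: powr_realpow)
      also have "\<dots> = s powr p * s powr p" using s by (simp add: p_def powr_add[symmetric])
      finally have "(2 * (s / 8)) ^ k * S \<le> (s powr p * s powr p) * S"
        using C m M_ge by (intro mult_right_mono) (auto simp: S_def)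
      also have "\<dots> = s powr p * (C * 2 powr p + s powr p * M)"
        using s by (simp add: S_def powr_minus powr_divide field_simps)
      also have "\<dots> \<le> s powr p * B"
      proof -
        have "s powr p * M \<le> 1 * M" using s p m M_ge by (intro mult_right_mono powr_le1) auto
        then show ?thesis by (intro mult_left_mono) (auto simp: B_def)
      qed
      also have "\<dots> \<le> m / (2 * B) * B" using sp B by (intro mult_right_mono) auto
      finally show "(2 * (s / 8)) ^ k * S \<le> m / 2" using B by simp
    qed (use s C in \<open>auto simp: s_def[symmetric] S_def\<close>)
    then show ?thesis using s by (simp add: s_def[symmetric] field_simps)
  qed
  show ?thesis
  proof (rule that[of "r / 2"])
    fix x z :: 'a assume x: "x \<noteq> 0" "norm x \<le> r / 2" and z: "z \<in> cball x (norm x / (16 * k))"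
    have k2: "real k \<ge> 2" using k by simp
    have nx: "norm x > 0" using x by simp
    have small: "norm x / (16 * k) \<le> norm x / 2"
      using nx k2 by (intro divide_left_mono) auto
    have near: "norm x / 2 \<le> norm z \<and> norm z \<le> 2 * norm x" if "z \<in> cball x (norm x / (16 * k))" for z
      using norm_near[of z x "norm x / 2"] that small by (auto simp: dist_norm norm_minus_commute)
    have inO: "z \<in> \<Omega>" if "z \<in> cball x (norm x / (16 * k))" for z
      using near[OF that] nx x r by (auto simp: \<Omega>_def)
    show "v x / 2 \<le> v z"
    proof (rule half_bound[OF _ _ _ z])
      show "cball x (norm x / (16 * k)) \<subseteq> \<Omega>" using inO by blast
      show "norm (grad v z) \<le> 8 * k / norm x * v z" if zz: "z \<in> cball x (norm x / (16 * k))" for z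
      proof -
        have "norm (grad v z) \<le> 4 * k / norm z * v z"
          using near[OF zz] nx x by (intro grad) auto
        also have "\<dots> \<le> 4 * k / (norm x / 2) * v z"
        proof -
          have "norm x / 2 \<le> norm z" "norm z > 0" using near[OF zz] nx by linarith+
          then show ?thesis
            using nx positive[of v, OF _ inO[OF zz]] by (intro mult_right_mono divide_left_mono) auto
        qed
        finally show ?thesis by (simp add: field_simps)
      qed
    qed (use nx k2 in simp)
  qed (use r in auto)
qed

end

section \<open>Decay of the charge\<close>

context bounded_first
begin

text \<open>On a ball about \<open>b\<close> of radius proportional to \<open>|b|\<close>, the function \<open>- \<Delta> u\<close> is at least a multiple of
  \<open>(v b) powr (1 + a)\<close>. Passing from the ball of radius \<open>4 |b|\<close> to that of radius \<open>|b|\<close> this raises any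
  lower bound for \<open>u\<close> by a fixed multiple of the charge \<open>(v b) powr (1 + a) |b|\<^sup>2\<close>.\<close>

lemma lift_lower_bound:
  obtains c r where "c > 0" "r > 0" "r \<le> 1 / 8"
    "\<And>b lo x. b \<noteq> 0 \<Longrightarrow> norm b \<le> r \<Longrightarrow> (\<forall>x. x \<noteq> 0 \<longrightarrow> norm x \<le> 4 * norm b \<longrightarrow> lo \<le> u x) \<Longrightarrow>
      x \<noteq> 0 \<Longrightarrow> norm x \<le> norm b \<Longrightarrow> lo + c * (v b powr (1 + a) * (norm b)\<^sup>2) \<le> u x"
proof -
  obtain r where r: "0 < r" "r \<le> 1 / 8"
    and har: "\<And>x z. x \<noteq> 0 \<Longrightarrow> norm x \<le> r \<Longrightarrow> z \<in> cball x (norm x / (16 * k)) \<Longrightarrow> v x / 2 \<le> v z"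
    using harnack by blast
  define \<theta> where "\<theta> = 1 / (16 * real k)"
  have \<theta>: "0 < \<theta>" "\<theta> \<le> 1 / 2" using k by (auto simp: \<theta>_def field_simps)
  define c1 where "c1 = \<beta> * m powr a / 2 powr (1 + a)"
  define c2 where "c2 = c1 / (2 * DIM('a)) * (\<theta>\<^sup>2 * (3 / 4))"
  have c1: "c1 > 0" using coeff m by (simp add: c1_def)
  have c2: "c2 > 0" using c1 \<theta> dim by (simp add: c2_def)
  define c where "c = c2 * min 1 ((\<theta> / 2) ^ k * (1 / 2 ^ k - 1 / 3 ^ k))"
  have "(1::real) / 3 ^ k < 1 / 2 ^ k"
    using k by (intro divide_strict_left_mono power_strict_mono) auto
  then have c: "c > 0" "c \<le> c2" "c \<le> c2 * ((\<theta> / 2) ^ k * (1 / 2 ^ k - 1 / 3 ^ k))"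
    using c2 \<theta> by (auto simp: c_def)
  show ?thesis
  proof (rule that[OF c(1) r])
    fix b x :: 'a and lo
    assume b: "b \<noteq> 0" "norm b \<le> r" and lo_all: "\<forall>x. x \<noteq> 0 \<longrightarrow> norm x \<le> 4 * norm b \<longrightarrow> lo \<le> u x"
      and x: "x \<noteq> 0" "norm x \<le> norm b"
    have lo: "lo \<le> u x" if "x \<noteq> 0" "norm x \<le> 4 * norm b" for x
      using lo_all that by blast
    define s where "s = norm b"
    have s: "0 < s" "s \<le> 1 / 8" using b r by (auto simp: s_def)
    define t where "t = v b powr (1 + a) * s\<^sup>2"
    have t: "t \<ge> 0" by (simp add: t_def)
    define \<rho> where "\<rho> = \<theta> * s"
    have \<rho>: "0 < \<rho>" "\<rho> \<le> s / 2" using \<theta> s by (auto simp: \<rho>_def)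
    have vb: "v b > 0" using positive[of v b] b s by (simp add: \<Omega>_def s_def)
    have mem: "s / 2 \<le> norm z \<and> norm z \<le> 3 / 2 * s" if "z \<in> cball b \<rho>" for z
      using norm_near[of z b \<rho>] that \<rho> by (simp add: dist_norm norm_minus_commute s_def)
    have inD: "z \<in> D" if "z \<in> cball b \<rho>" for z
      using mem[OF that] s by (auto simp: D_def)
    have inner: "lo + c2 * t \<le> u z" if z: "norm (z - b) \<le> \<rho> / 2" for z
    proof -
      define q where "q = c1 * v b powr (1 + a)"
      have q: "q \<ge> 0" using c1 by (simp add: q_def)
      have zc: "z \<in> cball b \<rho>" using z \<rho> by (simp add: dist_norm norm_minus_commute)
      have "lo + q / (2 * DIM('a)) * (\<rho>\<^sup>2 - (norm (z - b))\<^sup>2) \<le> u z"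
      proof (rule superharmonic_paraboloid[OF _ q _ _ zc])
        show "continuous_on (cball b \<rho>) u" by (rule cont) (use inD D_subset in auto)
        show "lo \<le> u y" if "y \<in> cball b \<rho>" for y
          using lo[of y] mem[OF that] inD[OF that] s by (auto simp: s_def D_def)
        show "\<exists>L\<le>- q. has_laplacian u L y" if y: "y \<in> ball b \<rho>" for y
        proof -
          have yc: "y \<in> cball b \<rho>" using y by simp
          have yD: "y \<in> D" "y \<in> \<Omega>" using inD[OF yc] D_subset by auto
          have "v b / 2 \<le> v y" using har[of b y] b yc by (simp add: \<rho>_def \<theta>_def s_def)
          then have "(v b / 2) powr (1 + a) \<le> v y powr (1 + a)"
            using vb a_bounds by (intro powr_mono2) auto
          moreover have "m powr a \<le> u y powr a"
            using m m_le[of u y] yD a_bounds by (intro powr_mono2) auto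
          ultimately have "\<beta> * (m powr a * (v b / 2) powr (1 + a)) \<le> \<beta> * (u y powr a * v y powr (1 + a))"
            using coeff by (intro mult_left_mono mult_mono) auto
          also have "\<dots> \<le> reaction \<mu>1 (u y) (v y)" using coeff by (simp add: reaction_def)
          also have "\<beta> * (m powr a * (v b / 2) powr (1 + a)) = q"
            using vb by (simp add: q_def c1_def powr_divide)
          finally show ?thesis using lap(1)[OF yD(2)] by (intro exI[of _ "- reaction \<mu>1 (u y) (v y)"]) auto
        qed
      qed
      moreover have "(norm (z - b))\<^sup>2 \<le> (\<rho> / 2)\<^sup>2" using z by (intro power_mono) auto
      then have "\<rho>\<^sup>2 * (3 / 4) \<le> \<rho>\<^sup>2 - (norm (z - b))\<^sup>2" by (simp add: power_divide)
      then have "q / (2 * DIM('a)) * (\<rho>\<^sup>2 * (3 / 4)) \<le> q / (2 * DIM('a)) * (\<rho>\<^sup>2 - (norm (z - b))\<^sup>2)"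
        using q by (intro mult_left_mono) auto
      moreover have "q / (2 * DIM('a)) * (\<rho>\<^sup>2 * (3 / 4)) = c2 * t"
        by (simp add: q_def c2_def t_def \<rho>_def power_mult_distrib)
      ultimately show ?thesis by linarith
    qed
    \<comment> \<open>The multiple of the fundamental solution with pole \<open>b\<close> that equals \<open>c2 * t\<close> on the sphere of radius \<open>\<rho> / 2\<close>;
      subtracting its value at distance \<open>3 s\<close> makes it nonpositive on the
      sphere of radius \<open>4 s\<close> about the origin.\<close>
    define A where "A = c2 * t * (\<rho> / 2) ^ k"
    have A: "A \<ge> 0" using c2 t \<rho> by (simp add: A_def)
    have Aeq: "A * norm z powr - real k = c2 * t * (\<rho> / 2 / norm z) ^ k" if "z \<noteq> 0" for z :: 'a
      using that by (simp add: A_def powr_minus powr_realpow power_divide field_simps)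
    let ?K = "cball 0 (4 * s) - ball b (\<rho> / 2)"
    let ?f = "\<lambda>z. u z - lo - (A * norm (z - b) powr - real k - A * (3 * s) powr - real k)"
    have outer: "0 \<le> ?f z" if z: "z \<in> ?K" "z \<noteq> 0" for z
    proof (rule punctured_min_principle_powr[where K = ?K and f = ?f and p = 0 and B = "c2 * t"])
      show "compact ?K" by (intro compact_diff) auto
      show "continuous_on (?K - {0}) ?f"
        using \<rho> s by (intro continuous_intros cont) (auto simp: \<Omega>_def)
      have far: "A * norm (z - b) powr - real k \<le> c2 * t" if z: "z \<in> ?K" for z
      proof -
        have n: "\<rho> / 2 \<le> norm (z - b)" using z by (simp add: dist_norm norm_minus_commute)
        then have "\<rho> / 2 / norm (z - b) \<le> 1" using \<rho> by (subst divide_le_eq_1_pos) linarith+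
        then have "(\<rho> / 2 / norm (z - b)) ^ k \<le> 1" using \<rho> by (intro power_le_one) auto
        then have "c2 * t * (\<rho> / 2 / norm (z - b)) ^ k \<le> c2 * t * 1"
          using c2 t by (intro mult_left_mono) auto
        moreover have "z - b \<noteq> 0" using n \<rho> by auto
        note Aeq[OF this]
        ultimately show ?thesis by linarith
      qed
      have A3: "0 \<le> A * (3 * s) powr - real k" using A by simp
      show "0 \<le> ?f z \<or> z \<in> interior ?K \<and> (\<exists>L\<le>0. has_laplacian ?f L z)"
        if z: "z \<in> ?K" "z \<noteq> 0" for z
      proof -
        have n: "\<rho> / 2 \<le> norm (z - b)" "norm z \<le> 4 * s" using z by (auto simp: dist_norm norm_minus_commute)
        have z\<Omega>: "z \<in> \<Omega>" using n z s by (auto simp: \<Omega>_def)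
        consider "norm (z - b) = \<rho> / 2" | "norm z = 4 * s" | "\<rho> / 2 < norm (z - b)" "norm z < 4 * s"
          using n by linarith
        then show ?thesis
        proof cases
          case 1
          then show ?thesis using far[OF z(1)] A3 inner[of z] by auto
        next
          case 2
          have "3 * s \<le> norm (z - b)" using norm_triangle_ineq2[of z b] 2 by (simp add: s_def)
          then have "norm (z - b) powr - real k \<le> (3 * s) powr - real k"
            using s by (intro powr_mono2') auto
          then have "A * norm (z - b) powr - real k \<le> A * (3 * s) powr - real k"
            using A by (rule mult_left_mono)
          then show ?thesis using lo[of z] z 2 by (simp add: s_def)
        next
          case 3
          have "open (ball 0 (4 * s) \<inter> (- cball b (\<rho> / 2)))" by (intro open_Int) auto
          then have int: "z \<in> interior ?K"
            by (rule interiorI) (use 3 in \<open>auto simp: dist_norm norm_minus_commute\<close>)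
          obtain L where L: "L \<le> 0" "has_laplacian u L z" using superharmonic[of u] z\<Omega> by blast
          have "has_laplacian ?f (L - 0 - (A * (- real k * (- real k + DIM('a) - 2) * norm (z - b) powr (- real k - 2)) - 0)) z"
            using n \<rho> by (intro has_laplacian_diff has_laplacian_cmult has_laplacian_const has_laplacian_norm_powr L) auto
          moreover have "L - 0 - (A * (- real k * (- real k + DIM('a) - 2) * norm (z - b) powr (- real k - 2)) - 0) \<le> 0"
            using L by (simp add: dim)
          ultimately show ?thesis using int by blast
        qed
      qed
      show "- (c2 * t) * norm z powr 0 \<le> ?f z" if z: "z \<in> ?K" "z \<noteq> 0" for z
        using far[OF z(1)] A3 lo[of z] z by (simp add: s_def)
    qed (use z k dim in auto)
    have ct: "c * t \<le> c2 * t" using c t by (intro mult_right_mono) auto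
    have "lo + c * t \<le> u x"
    proof (cases "norm (x - b) \<le> \<rho> / 2")
      case True
      then show ?thesis using inner[of x] ct by linarith
    next
      case False
      moreover have "norm x \<le> 4 * s" using x norm_ge_zero[of b] unfolding s_def by linarith
      ultimately have xK: "x \<in> ?K" by (simp add: dist_norm norm_minus_commute)
      have n: "0 < norm (x - b)" "norm (x - b) \<le> 2 * s"
        using False \<rho> norm_triangle_ineq4[of x b] x by (auto simp: s_def)
      have "A * (2 * s) powr - real k \<le> A * norm (x - b) powr - real k"
        using n A by (intro mult_left_mono powr_mono2') auto
      then have "A * (2 * s) powr - real k - A * (3 * s) powr - real k \<le> u x - lo"
        using outer[OF xK x(1)] by linarith
      moreover have "A * (2 * s) powr - real k - A * (3 * s) powr - real k
          = c2 * ((\<theta> / 2) ^ k * (1 / 2 ^ k - 1 / 3 ^ k)) * t"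
        using s by (simp add: A_def \<rho>_def powr_minus powr_realpow power_mult_distrib power_divide field_simps)
      moreover have "c * t \<le> c2 * ((\<theta> / 2) ^ k * (1 / 2 ^ k - 1 / 3 ^ k)) * t"
        using c t by (intro mult_right_mono) auto
      ultimately show ?thesis by linarith
    qed
    then show "lo + c * (v b powr (1 + a) * (norm b)\<^sup>2) \<le> u x" by (simp add: t_def s_def)
  qed
qed

text \<open>As \<open>u\<close> is bounded, only finitely many scales can carry a charge of size \<open>e\<close>.\<close>

lemma charge_vanishes:
  assumes e: "e > 0"
  obtains r where "r > 0" "\<And>x. x \<noteq> 0 \<Longrightarrow> norm x \<le> r \<Longrightarrow> v x powr (1 + a) * (norm x)\<^sup>2 \<le> e"
proof -
  obtain c r where c: "c > 0" "r > 0" "r \<le> 1 / 8"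
    and lift: "\<And>b lo x. b \<noteq> 0 \<Longrightarrow> norm b \<le> r \<Longrightarrow> (\<forall>x. x \<noteq> 0 \<longrightarrow> norm x \<le> 4 * norm b \<longrightarrow> lo \<le> u x) \<Longrightarrow>
      x \<noteq> 0 \<Longrightarrow> norm x \<le> norm b \<Longrightarrow> lo + c * (v b powr (1 + a) * (norm b)\<^sup>2) \<le> u x"
    using lift_lower_bound by blast
  have "\<exists>r>0. \<forall>x. x \<noteq> 0 \<and> norm x \<le> r \<longrightarrow> v x powr (1 + a) * (norm x)\<^sup>2 \<le> e"
  proof (rule ccontr)
    assume no: "\<not> ?thesis"
    have "\<exists>r>0. r \<le> 1 \<and> (\<forall>x. x \<noteq> 0 \<and> norm x \<le> r \<longrightarrow> of_nat j * (c * e) \<le> u x)" for j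
    proof (induction j)
      case 0
      have "0 \<le> u x" if "x \<noteq> 0" "norm x \<le> 1" for x
        using positive[of u x] that by (simp add: \<Omega>_def)
      then show ?case by (intro exI[of _ 1]) auto
    next
      case (Suc j)
      then obtain s where s: "s > 0" "s \<le> 1" "\<And>x. x \<noteq> 0 \<Longrightarrow> norm x \<le> s \<Longrightarrow> of_nat j * (c * e) \<le> u x" by blast
      have "min r (s / 4) > 0" using c s by simp
      with no obtain b where b: "b \<noteq> 0" "norm b \<le> min r (s / 4)" "v b powr (1 + a) * (norm b)\<^sup>2 > e"
        by (meson not_le)
      have "of_nat (Suc j) * (c * e) \<le> u x" if x: "x \<noteq> 0" "norm x \<le> norm b" for x
      proof -
        have "of_nat j * (c * e) + c * (v b powr (1 + a) * (norm b)\<^sup>2) \<le> u x"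
          using b s x by (intro lift) auto
        moreover have "c * e \<le> c * (v b powr (1 + a) * (norm b)\<^sup>2)"
          using b c by (intro mult_left_mono) auto
        ultimately show ?thesis by (simp add: distrib_right)
      qed
      moreover have "0 < norm b" "norm b \<le> 1" using b c by auto
      ultimately show ?case by blast
    qed
    moreover obtain j :: nat where j: "of_nat j * (c * e) > M"
      using reals_Archimedean3[of "c * e"] c e by auto
    ultimately obtain s where s: "s > 0" "s \<le> 1" "\<And>x. x \<noteq> 0 \<Longrightarrow> norm x \<le> s \<Longrightarrow> of_nat j * (c * e) \<le> u x"
      by blast
    obtain b :: 'a where b: "b \<in> Basis" using nonempty_Basis by blast
    have "s *\<^sub>R b \<in> D" "s *\<^sub>R b \<noteq> 0" "norm (s *\<^sub>R b) \<le> s" using b s by (auto simp: D_def)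
    then have "of_nat j * (c * e) \<le> M" by (intro order_trans[OF s(3) M])
    then show False using j by simp
  qed
  then obtain r' where "r' > 0" "\<And>x. x \<noteq> 0 \<Longrightarrow> norm x \<le> r' \<Longrightarrow> v x powr (1 + a) * (norm x)\<^sup>2 \<le> e"
    by auto
  then show ?thesis by (rule that)
qed

end

section \<open>Boundedness\<close>

context bounded_first
begin

text \<open>As \<open>u\<close> is at most a multiple of \<open>v\<close>, the right-hand side of the equation for \<open>v\<close> is
  controlled by the critical power of \<open>v\<close>.\<close>

lemma reaction_le:
  obtains C where "C > 0" "\<And>x. x \<in> D \<Longrightarrow> reaction \<mu>2 (v x) (u x) \<le> C * v x powr (1 + 2 * a)"
proof (rule that[of "\<mu>2 + \<beta> * (M / m) powr (1 + a)"])
  show "\<mu>2 + \<beta> * (M / m) powr (1 + a) > 0" using coeff by (simp add: add_pos_nonneg)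
  fix x assume x: "x \<in> D"
  have vm: "m \<le> v x" "m \<le> u x" using m_le x by auto
  have "u x \<le> M / m * m" using M[OF x] m by simp
  also have "\<dots> \<le> M / m * v x" using vm m M_ge by (intro mult_left_mono) auto
  finally have "u x powr (1 + a) \<le> (M / m * v x) powr (1 + a)"
    using vm m a_bounds by (intro powr_mono2) auto
  also have "\<dots> = (M / m) powr (1 + a) * v x powr (1 + a)"
    using vm m M_ge by (intro powr_mult)
  finally have "\<beta> * v x powr a * u x powr (1 + a)
      \<le> \<beta> * v x powr a * ((M / m) powr (1 + a) * v x powr (1 + a))"
    using coeff by (intro mult_left_mono) auto
  also have "\<dots> = \<beta> * (M / m) powr (1 + a) * (v x powr a * v x powr (1 + a))" by simp
  also have "v x powr a * v x powr (1 + a) = v x powr (1 + 2 * a)"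
    unfolding powr_add[symmetric] by (simp add: add.commute)
  finally show "reaction \<mu>2 (v x) (u x) \<le> (\<mu>2 + \<beta> * (M / m) powr (1 + a)) * v x powr (1 + 2 * a)"
    by (simp add: reaction_def distrib_right)
qed

text \<open>The equation for \<open>v\<close> now reads \<open>- \<Delta> v \<le> V v\<close> with \<open>V = C v powr (2 a)\<close>. Because \<open>a \<le> 1\<close> and \<open>v \<ge> m\<close>, the decay
  of the charge gives \<open>|x|\<^sup>2 V \<rightarrow> 0\<close>, so that \<open>|x| powr - \<delta>\<close> and \<open>|x| powr - (k - \<delta>)\<close> are supersolutions. The
  second one dominates the bound \<open>|x| powr - (k / 2)\<close>, whence \<open>v \<le> A |x| powr - \<delta>\<close>. With \<open>\<delta> (1 + 2 a) = 1\<close> this gives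
  \<open>- \<Delta> v \<le> C / |x|\<close>, and \<open>v + C |x|\<close> is a subharmonic function to which the punctured principle applies.\<close>

theorem v_bounded:
  obtains r B where "r > 0" "\<And>x. x \<noteq> 0 \<Longrightarrow> norm x \<le> r \<Longrightarrow> v x \<le> B"
proof -
  obtain C1 where C1: "C1 > 0" "\<And>x. x \<in> D \<Longrightarrow> reaction \<mu>2 (v x) (u x) \<le> C1 * v x powr (1 + 2 * a)"
    using reaction_le by blast
  obtain C where C: "C > 0" "\<And>x. x \<noteq> 0 \<Longrightarrow> norm x \<le> 1 / 4 \<Longrightarrow> v x * norm x powr (k / 2) \<le> C"
    using upper_bound by blast
  define \<delta> where "\<delta> = 1 / (1 + 2 * a)"
  define p where "p = real k / 2"
  have \<delta>: "0 < \<delta>" "\<delta> < p" "\<delta> * (1 + 2 * a) = 1"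
  proof -
    have "p = 1 / a" using k by (simp add: p_def a)
    moreover have "1 / (1 + 2 * a) < 1 / a" using a_bounds by (intro divide_strict_left_mono) auto
    ultimately show "0 < \<delta>" "\<delta> < p" "\<delta> * (1 + 2 * a) = 1" using a_bounds by (auto simp: \<delta>_def)
  qed
  have p: "p > 0" "real k = 2 * p" using k by (auto simp: p_def)
  define \<gamma> where "\<gamma> = \<delta> * (k - \<delta>)"
  have \<gamma>: "\<gamma> > 0" using \<delta> p by (simp add: \<gamma>_def)
  obtain r0 where r0: "r0 > 0" "\<And>x. x \<noteq> 0 \<Longrightarrow> norm x \<le> r0
      \<Longrightarrow> v x powr (1 + a) * (norm x)\<^sup>2 \<le> \<gamma> * m powr (1 - a) / (2 * C1)"
    using charge_vanishes[of "\<gamma> * m powr (1 - a) / (2 * C1)"] \<gamma> m C1(1) by auto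
  define r where "r = min r0 (1 / 4)"
  have r: "0 < r" "r \<le> r0" "r \<le> 1 / 4" using r0 by (auto simp: r_def)
  have inD: "x \<in> D" "x \<in> \<Omega>" if "x \<noteq> 0" "norm x \<le> r" for x
    using that r by (auto simp: D_def \<Omega>_def)
  have pot: "C1 * v x powr (2 * a) * (norm x)\<^sup>2 < \<gamma>" if x: "x \<noteq> 0" "norm x \<le> r" for x
  proof -
    have vm: "m \<le> v x" using m_le inD[OF x] by blast
    have "m powr (1 - a) * v x powr (2 * a) \<le> v x powr (1 - a) * v x powr (2 * a)"
      using vm m a_bounds by (intro mult_right_mono powr_mono2) auto
    also have "\<dots> = v x powr (1 + a)" unfolding powr_add[symmetric] by (simp add: add.commute)
    finally have "m powr (1 - a) * v x powr (2 * a) * (norm x)\<^sup>2 \<le> v x powr (1 + a) * (norm x)\<^sup>2"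
      by (intro mult_right_mono) auto
    also have "\<dots> \<le> \<gamma> * m powr (1 - a) / (2 * C1)" using r0(2)[of x] x r by simp
    finally have "m powr (1 - a) * (2 * C1 * v x powr (2 * a) * (norm x)\<^sup>2) \<le> m powr (1 - a) * \<gamma>"
      using C1(1) by (simp add: field_simps)
    then have "2 * C1 * v x powr (2 * a) * (norm x)\<^sup>2 \<le> \<gamma>" using m by simp
    then show ?thesis using \<gamma> by simp
  qed
  have sph: "sphere 0 r \<subseteq> \<Omega>" "sphere (0::'a) r \<noteq> {}" using r by (auto simp: \<Omega>_def)
  obtain z0 where z0: "z0 \<in> sphere 0 r" "\<And>x. x \<in> sphere 0 r \<Longrightarrow> v x \<le> v z0"
    using continuous_attains_sup[OF compact_sphere sph(2) cont[OF _ sph(1), of v]] by blast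
  define B where "B = v z0"
  have B: "B > 0" "\<And>x. norm x = r \<Longrightarrow> v x \<le> B"
    using z0 positive[of v z0] sph by (auto simp: B_def)
  define A where "A = B * r powr \<delta>"
  have A: "A > 0" "A * r powr - \<delta> = B" using B r by (simp_all add: A_def powr_minus)
  have barrier: "v x \<le> A * norm x powr - \<delta> + e * norm x powr - (k - \<delta>)"
    if x: "x \<noteq> 0" "norm x \<le> r" and e: "e > 0" for x e
  proof (rule ccontr)
    define g where "g z = A * norm (z - 0) powr - \<delta> + e * norm (z - 0) powr - (k - \<delta>)" for z :: 'a
    assume "\<not> ?thesis"
    then have gx: "g x < v x" by (simp add: g_def)
    define h where "h = k - \<delta> - p"
    have h: "h > 0" using \<delta> p by (simp add: h_def)
    \<comment> \<open>Inside this radius the second barrier alone exceeds the scale-invariant bound.\<close>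
    define r1 where "r1 = min (norm x) ((e / C) powr (1 / h))"
    have r1: "0 < r1" "r1 \<le> norm x" using x e C by (auto simp: r1_def)
    have gpos: "g z > 0" if "z \<noteq> 0" for z
      using that A e by (simp add: g_def add_pos_pos)
    have near0: "v z \<le> g z" if z: "z \<noteq> 0" "norm z \<le> r1" for z
    proof -
      have "norm z powr h \<le> ((e / C) powr (1 / h)) powr h"
        using z h by (intro powr_mono2) (auto simp: r1_def)
      also have "\<dots> = e / C" using h e C by (simp add: powr_powr)
      finally have "C * norm z powr h \<le> e" using C by (simp add: field_simps)
      then have "C * norm z powr h * norm z powr - (k - \<delta>) \<le> e * norm z powr - (k - \<delta>)"
        by (intro mult_right_mono) auto
      also have "C * norm z powr h * norm z powr - (k - \<delta>) = C * norm z powr - p"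
        by (simp add: h_def powr_add[symmetric] mult.assoc)
      finally have "C * norm z powr - p \<le> e * norm z powr - (k - \<delta>)" .
      moreover have "v z * norm z powr p \<le> C"
        using C(2)[OF z(1)] z r1 x r by (simp add: p_def)
      then have "v z \<le> C * norm z powr - p" using z by (simp add: powr_minus field_simps)
      moreover have "0 \<le> A * norm z powr - \<delta>" using A by simp
      ultimately show ?thesis by (simp add: g_def)
    qed
    define K where "K = cball (0::'a) r - ball 0 r1"
    have K0: "z \<noteq> 0" "norm z \<le> r" "r1 \<le> norm z" if "z \<in> K" for z
      using that r1 by (auto simp: K_def)
    have "compact K" unfolding K_def by (intro compact_diff) auto
    moreover have xK: "x \<in> K" using x r1 by (simp add: K_def)
    moreover have "continuous_on K v" by (rule cont) (use K0 inD in auto)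
    then have "continuous_on K (\<lambda>z. v z / g z)"
      unfolding g_def using K0 gpos[unfolded g_def]
      by (intro continuous_intros) (auto simp: less_imp_neq[THEN not_sym])
    ultimately obtain z where z: "z \<in> K" "\<And>w. w \<in> K \<Longrightarrow> v w / g w \<le> v z / g z"
      using continuous_attains_sup[of K "\<lambda>z. v z / g z"] by blast
    define \<kappa> where "\<kappa> = v z / g z"
    have "1 < v x / g x" using gx gpos x by simp
    then have \<kappa>: "\<kappa> > 1" using z(2)[OF xK] by (simp add: \<kappa>_def)
    have vz: "v z = \<kappa> * g z" using gpos[of z] K0[OF z(1)] by (simp add: \<kappa>_def)
    have gz: "g z < v z" using \<kappa> gpos[of z] K0[OF z(1)] by (simp add: vz)
    \<comment> \<open>A maximum point of \<open>v / g\<close> with \<open>v > g\<close> lies in the open annulus, and \<open>\<kappa> g\<close> touches \<open>v\<close> there from above.\<close>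
    have "norm z \<noteq> r"
    proof
      assume nr: "norm z = r"
      then have "B \<le> g z" using A e by (simp add: g_def)
      then show False using B(2)[OF nr] gz by simp
    qed
    moreover have "norm z \<noteq> r1" using near0[of z] K0[OF z(1)] gz by auto
    ultimately have "z \<in> ball 0 r \<inter> (- cball 0 r1)" using K0[OF z(1)] by auto
    moreover have "open (ball 0 r \<inter> (- cball (0::'a) r1))" by (intro open_Int) auto
    ultimately have "\<forall>\<^sub>F w in nhds z. w \<in> ball 0 r \<inter> (- cball 0 r1)"
      by (intro eventually_nhds_in_open)
    then have min: "\<forall>\<^sub>F w in nhds z. \<kappa> * g z - v z \<le> \<kappa> * g w - v w"
    proof eventually_elim
      case (elim w)
      then have wK: "w \<in> K" by (auto simp: K_def)
      have "v w \<le> \<kappa> * g w"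
        using z(2)[OF wK] gpos[of w] K0[OF wK] by (simp add: \<kappa>_def[symmetric] pos_divide_le_eq)
      then show ?case by (simp add: vz)
    qed
    have z\<Omega>: "z \<in> \<Omega>" "z \<in> D" using inD K0[OF z(1)] by auto
    let ?Lg = "A * (- \<delta> * (- \<delta> + DIM('a) - 2) * norm (z - 0) powr (- \<delta> - 2))
      + e * (- (k - \<delta>) * (- (k - \<delta>) + DIM('a) - 2) * norm (z - 0) powr (- (k - \<delta>) - 2))"
    have "has_laplacian g ?Lg z"
      unfolding g_def using K0[OF z(1)]
      by (intro has_laplacian_add has_laplacian_cmult has_laplacian_norm_powr) auto
    then have "has_laplacian (\<lambda>w. \<kappa> * g w - v w) (\<kappa> * ?Lg - - reaction \<mu>2 (v z) (u z)) z"
      by (intro has_laplacian_diff has_laplacian_cmult lap z\<Omega>)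
    from has_laplacian_local_min[OF this min]
    have ge: "- (\<kappa> * ?Lg) \<le> reaction \<mu>2 (v z) (u z)" by simp
    have n0: "norm z > 0" using K0[OF z(1)] by simp
    have n2: "norm z powr (s - 2) = norm z powr s / (norm z)\<^sup>2" for s
      using n0 by (simp add: powr_diff)
    have "?Lg = - (\<gamma> / (norm z)\<^sup>2 * g z)"
      unfolding n2 diff_zero g_def by (simp add: \<gamma>_def dim algebra_simps add_divide_distrib diff_divide_distrib)
    then have "\<gamma> / (norm z)\<^sup>2 * v z \<le> reaction \<mu>2 (v z) (u z)" using ge by (simp add: vz mult_ac)
    also have "\<dots> \<le> C1 * v z powr (1 + 2 * a)" by (rule C1(2)[OF z\<Omega>(2)])
    also have "v z powr (1 + 2 * a) = v z powr (2 * a) * v z"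
      using positive[of v z] z\<Omega> by (simp add: powr_add)
    finally have "\<gamma> / (norm z)\<^sup>2 * v z \<le> (C1 * v z powr (2 * a)) * v z" by simp
    then have "\<gamma> / (norm z)\<^sup>2 \<le> C1 * v z powr (2 * a)"
      by (rule mult_right_le_imp_le) (use positive[of v z] z\<Omega> in blast)
    then have "\<gamma> \<le> C1 * v z powr (2 * a) * (norm z)\<^sup>2" using n0 by (simp add: pos_divide_le_eq)
    then show False using pot[of z] K0[OF z(1)] by simp
  qed
  have weak: "v x \<le> A * norm x powr - \<delta>" if x: "x \<noteq> 0" "norm x \<le> r" for x
  proof (rule field_le_epsilon)
    fix e :: real assume "e > 0"
    then show "v x \<le> A * norm x powr - \<delta> + e"
      using barrier[OF x, of "e / norm x powr - (k - \<delta>)"] x by simp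
  qed
  define C2 where "C2 = C1 * A powr (1 + 2 * a)"
  have C2: "C2 > 0" using C1(1) A by (simp add: C2_def)
  have rhs: "reaction \<mu>2 (v x) (u x) \<le> C2 * norm x powr (1 - 2)" if x: "x \<noteq> 0" "norm x \<le> r" for x
  proof -
    have "v x powr (1 + 2 * a) \<le> (A * norm x powr - \<delta>) powr (1 + 2 * a)"
      using weak[OF x] positive[of v x] inD[OF x] a_bounds by (intro powr_mono2) auto
    also have "\<dots> = A powr (1 + 2 * a) * norm x powr (- \<delta> * (1 + 2 * a))"
      using A by (simp add: powr_mult powr_powr)
    also have "- \<delta> * (1 + 2 * a) = 1 - 2" using \<delta>(3) by simp
    finally have "C1 * v x powr (1 + 2 * a) \<le> C1 * (A powr (1 + 2 * a) * norm x powr (1 - 2))"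
      using C1(1) by (intro mult_left_mono) auto
    then show ?thesis using C1(2)[OF inD(1)[OF x]] by (simp add: C2_def mult.assoc)
  qed
  show ?thesis
  proof (rule that[OF r(1)])
    fix x :: 'a assume x: "x \<noteq> 0" "norm x \<le> r"
    let ?f = "\<lambda>z. (B + C2 * r) - v z - C2 * norm (z - 0) powr 1"
    have "0 \<le> ?f x"
    proof (rule punctured_min_principle_powr[where K = "cball 0 r" and f = ?f and p = "- \<delta>" and B = A])
      have "cball 0 r - {0} \<subseteq> \<Omega>" using r by (auto simp: \<Omega>_def)
      then have "continuous_on (cball 0 r - {0}) v" by (intro cont disjI2 refl)
      then show "continuous_on (cball 0 r - {0}) ?f"
        by (intro continuous_intros) auto
      show "0 \<le> ?f z \<or> z \<in> interior (cball 0 r) \<and> (\<exists>L\<le>0. has_laplacian ?f L z)"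
        if z: "z \<in> cball 0 r" "z \<noteq> 0" for z
      proof (cases "norm z = r")
        case True
        then show ?thesis using B(2)[of z] r by simp
      next
        case False
        have zr: "norm z \<le> r" using z by simp
        have lapf: "has_laplacian ?f (0 - - reaction \<mu>2 (v z) (u z)
            - C2 * (1 * (1 + real DIM('a) - 2) * norm (z - 0) powr (1 - 2))) z"
          by (intro has_laplacian_diff has_laplacian_const has_laplacian_cmult has_laplacian_norm_powr
              lap inD z zr)
        have "0 \<le> C2 * k * norm z powr (1 - 2)" using C2 by simp
        moreover have "C2 * (1 * (1 + real DIM('a) - 2) * norm (z - 0) powr (1 - 2))
            = C2 * norm z powr (1 - 2) + C2 * k * norm z powr (1 - 2)"
          by (simp add: dim algebra_simps add_divide_distrib)
        ultimately have "0 - - reaction \<mu>2 (v z) (u z)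
            - C2 * (1 * (1 + real DIM('a) - 2) * norm (z - 0) powr (1 - 2)) \<le> 0"
          using rhs[OF z(2) zr] by linarith
        moreover have "z \<in> interior (cball 0 r)" using False zr by (simp add: interior_cball)
        ultimately show ?thesis using lapf by blast
      qed
      show "- A * norm z powr - \<delta> \<le> ?f z" if z: "z \<in> cball 0 r" "z \<noteq> 0" for z
      proof -
        have "C2 * norm z \<le> C2 * r" using z C2 by simp
        moreover have "v z \<le> A * norm z powr - \<delta>" using weak z by simp
        ultimately show ?thesis using B(1) z by simp
      qed
    qed (use x \<delta> p dim in auto)
    moreover have "0 \<le> C2 * norm (x - 0) powr 1" using C2 by simp
    ultimately show "v x \<le> B + C2 * r" by linarith
  qed
qed

end

text \<open>Boundedness near the origin passes from one component to the other.\<close>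

lemma (in positive_pair) bounded_transfer:
  assumes bu: "Bfun u (at 0)"
  shows "Bfun v (at 0)"
proof -
  obtain m where m: "m > 0" "\<And>w x. w = u \<or> w = v \<Longrightarrow> x \<in> D \<Longrightarrow> m \<le> w x"
    using lower_bound by blast
  obtain K where K: "K > 0" "\<forall>\<^sub>F x in at 0. norm (u x) \<le> K"
    using bu unfolding Bfun_def by blast
  obtain d where d: "d > 0" "\<And>x. x \<noteq> 0 \<Longrightarrow> norm x < d \<Longrightarrow> norm (u x) \<le> K"
    using K(2) unfolding eventually_at by (auto simp: dist_norm)
  have "compact (cball 0 1 - ball (0::'a) d)" by (intro compact_diff) auto
  moreover have "continuous_on (cball 0 1 - ball 0 d) u"
    by (rule cont) (use d in \<open>auto simp: \<Omega>_def\<close>)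
  ultimately have "bounded (u ` (cball 0 1 - ball 0 d))"
    by (intro compact_imp_bounded compact_continuous_image)
  then obtain K' where K': "\<And>x. x \<in> cball 0 1 - ball 0 d \<Longrightarrow> norm (u x) \<le> K'"
    unfolding bounded_iff by blast
  have M: "u x \<le> max K K'" if "x \<in> D" for x
    using that d(2)[of x] K'[of x] by (cases "norm x < d") (auto simp: D_def)
  interpret bounded_first u v k \<mu>1 \<mu>2 \<beta> a m "max K K'"
    by unfold_locales (use m M in auto)
  obtain r B where r: "r > 0" "\<And>x. x \<noteq> 0 \<Longrightarrow> norm x \<le> r \<Longrightarrow> v x \<le> B"
    using v_bounded by blast
  have "\<forall>\<^sub>F x in at 0. norm (v x) \<le> B"
    unfolding eventually_at
  proof (intro exI[of _ "min r 1"] conjI ballI impI)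
    fix x :: 'a assume x: "x \<noteq> 0 \<and> dist x 0 < min r 1"
    then have "v x > 0" by (intro positive) (auto simp: \<Omega>_def)
    then show "norm (v x) \<le> B" using r(2)[of x] x by simp
  qed (use r in auto)
  then show ?thesis by (rule BfunI)
qed

lemma positive_solution_pair:
  fixes u v :: "real^'n::finite \<Rightarrow> real"
  assumes N: "CARD('n) \<ge> 4" and coeff: "\<mu>1 > 0" "\<mu>2 > 0" "\<beta> > 0"
    and sol: "positive_solution \<mu>1 \<mu>2 \<beta> u v"
  shows "positive_pair u v (CARD('n) - 2) \<mu>1 \<mu>2 \<beta> (2 / real (CARD('n) - 2))"
proof -
  define k where "k = CARD('n) - 2"
  define a where "a = 2 / real k"
  have k: "CARD('n) = k + 2" "k \<ge> 2" using N by (auto simp: k_def)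
  have p: "critical_exponent CARD('n) = 2 + 2 * a"
    using k(2) unfolding critical_exponent_def k(1) by (simp add: a_def field_simps)
  have e: "critical_exponent CARD('n) - 1 = 1 + 2 * a" "critical_exponent CARD('n) / 2 = 1 + a"
    "1 + a - 1 = a" unfolding p by (auto simp: add_divide_distrib)
  note S = sol[unfolded positive_solution_def Let_def e]
  have "positive_pair u v k \<mu>1 \<mu>2 \<beta> a"
  proof
    show "DIM(real^'n) = k + 2" "k \<ge> 2" "a = 2 / real k" using k by (auto simp: a_def)
  qed (use S coeff in blast)+
  then show ?thesis by (simp add: a_def k_def)
qed

theorem theorem1p2:
  fixes \<mu>\<^sub>1 \<mu>\<^sub>2 \<beta> :: real
  assumes "CARD('n::finite) \<ge> 4"
    and "\<mu>\<^sub>1 > 0" and "\<mu>\<^sub>2 > 0" and "\<beta> > 0"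
  shows "\<not> (\<exists>u v :: real^'n \<Rightarrow> real. positive_solution \<mu>\<^sub>1 \<mu>\<^sub>2 \<beta> u v \<and> semi_singular u v)"
proof
  assume "\<exists>u v :: real^'n \<Rightarrow> real. positive_solution \<mu>\<^sub>1 \<mu>\<^sub>2 \<beta> u v \<and> semi_singular u v"
  then obtain u v :: "real^'n \<Rightarrow> real"
    where sol: "positive_solution \<mu>\<^sub>1 \<mu>\<^sub>2 \<beta> u v" and semi: "semi_singular u v" by blast
  interpret positive_pair u v "CARD('n) - 2" \<mu>\<^sub>1 \<mu>\<^sub>2 \<beta> "2 / real (CARD('n) - 2)"
    using positive_solution_pair[OF assms sol] .
  have "Bfun u (at 0) \<longleftrightarrow> Bfun v (at 0)"
    using bounded_transfer positive_pair.bounded_transfer[OF swap] by blast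
  then show False using semi unfolding semi_singular_def by blast
qed

end
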